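(* Let $X=\mathbb{R}\times\mathbb{T}$, and let $\alpha=\left(\begin{matrix}a&b\\0&1\end{matrix}\right)$ be a topological automorphism of $X$, i.e. $\alpha(t,z)=(at,e^{ibt}z)$ with $a,b\in\mathbb{R}$, $a\neq0$. Let $\xi_1$ and $\xi_2$ be independent random variables with values in $X$ and distributions $\mu_1$ and $\mu_2$. If the conditional distribution of the linear form $L_2=\xi_1+\alpha\xi_2$ given $L_1=\xi_1+\xi_2$ is symmetric, then the following statements hold. 1. If $a<0$ and $a\ne-1$, then there is the following alternative: either 1a. the distributions $\mu_j$, $j=1,2$, are represented in the form $\mu_j=\tau(M_j)*E_{x_j}$, where $x_j\in X$ and $M_j$ are distributions on the group $\mathbb{R}\times\mathbb{Z}(2)$ belonging to the class $\Lambda$, and at least one of the distributions $\mu_j$ is represented in the form $\mu_j=\gamma_j*m_G*E_{x_j}$, where $\gamma_j\in\Gamma(F)$; or 1b. the distributions $\mu_j$, $j=1,2$, are represented in the form $\mu_j=\tau(M_j)*E_{x_j}$, where $x_j\in X$ and $M_j$ are distributions on the group $\mathbb{R}\times\mathbb{Z}(2)$ belonging to the class $\Theta$, and the characteristic functions $\hat\mu_j(y)$ do not vanish. 2. If $a=-1$, then the distributions $\mu_j$ are of the form $\mu_j=\lambda_j*E_{x_j}$, where $x_j\in X$ and $\lambda_j\in \mathrm{M}^1(F\times G)$, $j=1,2$. Furthermore, either $\lambda_2=\lambda_1*\omega_1$ or $\lambda_1=\lambda_2*\omega_2$, where $\omega_j\in\mathrm{M}^1(G)$. 3. If $a>0$,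 then some shifts of the distributions $\mu_j$ are supported in $G$.
   Context: $\mathbb{T}$ is the circle group (complex numbers of absolute value 1); $\mathbb{Z}(2)=\{0,1\}$ is the group of residue classes modulo 2. Elements of $X=\mathbb{R}\times\mathbb{T}$ are $(t,z)$; the group operation of $X$ is written additively. The character group $Y$ of $X$ is identified with $\mathbb{R}\times\mathbb{Z}$. For a probability distribution $\mu$ on a locally compact Abelian group with character group $Y$, $\hat\mu(y)=\int (x,y)\,d\mu(x)$ is its characteristic function; $*$ is convolution; $E_x$ is the degenerate distribution at $x$; a shift of $\mu$ is a distribution $\mu*E_x$. For a Borel subgroup $H$ of $X$, $\mathrm{M}^1(H)$ is the set of probability distributions on $X$ concentrated on $H$. The conditional distribution of $L_2$ given $L_1$ is symmetric if, equivalently, $(L_1,L_2)$ and $(L_1,-L_2)$ are identically distributed. $G=\{(0,\pm1)\}$ is the subgroup of $X$ generated by the element of order 2, and $m_G$ is its Haar (uniform) probability distribution. For $a\neq1$, $\tau\colon\mathbb{R}\times\mathbb{Z}(2)\to X$ is the continuous monomorphism $$\tau(t,k)=\left(t,(-1)^k e^{\frac{ibt}{a-1}}\right),\quad t\in\mathbb{R},\ k\in\mathbb{Z}(2),$$ $\tau(M)$ denotes the image of a distribution $M$ under $\tau$, and $F=\tau(\mathbb{R}\times\{0\})$, a closed subgroup of $X$ topologically isomorphic to $\mathbb{R}$. $F\times G$ denotes the (internal direct product) subgroup $\tau(\mathbb{R}\times\mathbb{Z}(2))$ of $X$. $\Gamma(F)$ is the set of Gaussian distributions (possibly degenerate) on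 $F\cong\mathbb{R}$, i.e. images under $t\mapsto\tau(t,0)$ of Gaussian distributions on $\mathbb{R}$, regarded as distributions on $X$. Class $\Lambda$: a probability distribution $M$ on $\mathbb{R}\times\mathbb{Z}(2)$ belongs to $\Lambda$ if its marginal $E\mapsto M(E\times\mathbb{Z}(2))$ on $\mathbb{R}$ is Gaussian (possibly degenerate). Class $\Theta$: identify the character group of $\mathbb{R}\times\mathbb{Z}(2)$ with $\mathbb{R}\times\mathbb{Z}(2)$ via $((t,k),(s,l))=e^{its}(-1)^{kl}$. A probability distribution $M$ on $\mathbb{R}\times\mathbb{Z}(2)$ belongs to $\Theta$ if $$\hat M(s,0)=\exp\{-\sigma s^2+i\beta s\},\qquad \hat M(s,1)=\kappa\exp\{-\sigma' s^2+i\beta' s\},\qquad s\in\mathbb{R},$$ with $\sigma,\sigma'\ge0$, $\beta,\beta',\kappa\in\mathbb{R}$, where either $0<\sigma'<\sigma$ and $0<|\kappa|\le\sqrt{\sigma'/\sigma}\,\exp\left\{-\frac{(\beta-\beta')^2}{4(\sigma-\sigma')}\right\}$, or $\sigma=\sigma'$, $\beta=\beta'$ and $|\kappa|\le1$. *)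

theory Defs
  imports "HOL-Probability.Probability" "HOL-Library.Z2"
begin

section \<open>The circle group\<close>

text \<open>The group operation of \<open>\<real> \<times> \<T>\<close> is written additively, so addition on \<open>circle\<close> is
  multiplication of complex numbers of absolute value 1.\<close>

typedef circle = "sphere (0::complex) 1"
  morphisms complex_of_circle circle_of_complex
  by (rule exI[of _ 1]) simp

setup_lifting type_definition_circle

instantiation circle :: ab_group_add
begin

lift_definition zero_circle :: circle is 1 by simp
lift_definition plus_circle :: "circle \<Rightarrow> circle \<Rightarrow> circle" is "(*)" by (simp add: norm_mult)
lift_definition uminus_circle :: "circle \<Rightarrow> circle" is inverse by (simp add: norm_inverse)
lift_definition minus_circle :: "circle \<Rightarrow> circle \<Rightarrow> circle" is "(/)" by (simp add: norm_divide)

instance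
proof
  fix x y z :: circle
  show "x + y + z = x + (y + z)" by transfer simp
  show "x + y = y + x" by transfer simp
  show "0 + x = x" by transfer simp
  show "- x + x = 0" by transfer (rule left_inverse, auto)
  show "x - y = x + - y" by transfer (simp add: divide_inverse)
qed

end

instantiation circle :: metric_space
begin

lift_definition dist_circle :: "circle \<Rightarrow> circle \<Rightarrow> real" is dist .

definition uniformity_circle :: "(circle \<times> circle) filter" where
  "uniformity_circle = (INF e\<in>{0<..}. principal {(x, y). dist x y < e})"

definition open_circle :: "circle set \<Rightarrow> bool" where
  "open_circle U \<longleftrightarrow> (\<forall>x\<in>U. eventually (\<lambda>(x', y). x' = x \<longrightarrow> y \<in> U) uniformity)"

instance
proof
  show "uniformity = (INF e\<in>{0<..}. principal {(x, y :: circle). dist x y < e})"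
    by (rule uniformity_circle_def)
  show "open U \<longleftrightarrow> (\<forall>x\<in>U. eventually (\<lambda>(x', y). x' = x \<longrightarrow> y \<in> U) uniformity)"
    for U :: "circle set" by (rule open_circle_def)
  show "dist x y = 0 \<longleftrightarrow> x = y" for x y :: circle by transfer simp
  show "dist x y \<le> dist x z + dist y z" for x y z :: circle
    by transfer (rule dist_triangle2)
qed

end

lemma tendsto_circle_iff:
  "(f \<longlongrightarrow> l) F \<longleftrightarrow> ((\<lambda>x. complex_of_circle (f x)) \<longlongrightarrow> complex_of_circle l) F"
  by (simp add: tendsto_iff dist_circle.rep_eq)

lemmas tendsto_complex_of_circle = tendsto_circle_iff[THEN iffD1]

instance circle :: topological_ab_group_add
proof
  fix a b :: circle
  have nz: "complex_of_circle a \<noteq> 0"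
    using complex_of_circle[of a] by auto
  show "((\<lambda>x. fst x + snd x) \<longlongrightarrow> a + b) (nhds a \<times>\<^sub>F nhds b)"
    unfolding tendsto_circle_iff plus_circle.rep_eq
    by (rule tendsto_mult; rule tendsto_complex_of_circle, rule filterlim_fst filterlim_snd)
  show "(uminus \<longlongrightarrow> - a) (nhds a)"
    unfolding tendsto_circle_iff uminus_circle.rep_eq
    by (rule tendsto_inverse[OF _ nz], rule tendsto_complex_of_circle, rule filterlim_ident)
qed

lemma open_vimage_complex_of_circle:
  assumes "open C"
  shows "open (complex_of_circle -` C)"
  unfolding open_dist
proof
  fix x assume "x \<in> complex_of_circle -` C"
  then obtain e where "e > 0" "\<And>w. dist w (complex_of_circle x) < e \<Longrightarrow> w \<in> C"
    using assms by (auto simp: open_dist)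
  then show "\<exists>e>0. \<forall>y. dist y x < e \<longrightarrow> y \<in> complex_of_circle -` C"
    by (intro exI[of _ e]) (simp add: dist_circle.rep_eq)
qed

instance circle :: second_countable_topology
proof
  obtain B :: "complex set set" where B: "countable B" "topological_basis B"
    using ex_countable_basis by blast
  let ?B = "(\<lambda>C. complex_of_circle -` C) ` B"
  have "topological_basis ?B"
  proof (rule topological_basisI)
    show "open S" if "S \<in> ?B" for S
      using that B(2) topological_basis_open open_vimage_complex_of_circle by blast
    fix O' :: "circle set" and x assume "open O'" "x \<in> O'"
    then obtain e where e: "e > 0" "\<And>y. dist y x < e \<Longrightarrow> y \<in> O'"
      unfolding open_dist by blast
    obtain C where C: "C \<in> B" "complex_of_circle x \<in> C" "C \<subseteq> ball (complex_of_circle x) e"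
      using topological_basisE[OF B(2) open_ball] e(1) centre_in_ball by metis
    have "y \<in> O'" if "complex_of_circle y \<in> C" for y
      using that C(3) by (intro e(2)) (auto simp: dist_circle.rep_eq dist_commute)
    then show "\<exists>S\<in>?B. x \<in> S \<and> S \<subseteq> O'"
      using C by blast
  qed
  then show "\<exists>B :: circle set set. countable B \<and> open = generate_topology B"
    using B(1) by (metis countable_image topological_basis_imp_subbasis)
qed

instance prod :: (topological_monoid_add, topological_monoid_add) topological_monoid_add
proof
  fix a b :: "'a \<times> 'b"
  have 1: "(fst \<longlongrightarrow> a) (nhds a \<times>\<^sub>F nhds b)" and 2: "(snd \<longlongrightarrow> b) (nhds a \<times>\<^sub>F nhds b)"
    by (rule filterlim_fst filterlim_snd)+
  show "((\<lambda>x. fst x + snd x) \<longlongrightarrow> a + b) (nhds a \<times>\<^sub>F nhds b)"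
    unfolding plus_prod_def
    by (rule tendsto_Pair; rule tendsto_add; rule tendsto_fst tendsto_snd; rule 1 2)
qed

instance prod :: (topological_group_add, topological_group_add) topological_group_add
proof
  fix a :: "'a \<times> 'b"
  show "(uminus \<longlongrightarrow> - a) (nhds a)"
    unfolding uminus_prod_def
    by (rule tendsto_Pair; rule tendsto_minus; rule tendsto_fst tendsto_snd; rule filterlim_ident)
qed

type_synonym X = "real \<times> circle"

section \<open>Distributions on \<open>X\<close>\<close>

text \<open>The library's convolution is only available on ordered Euclidean spaces.\<close>

definition convol :: "'a::{topological_space, plus} measure \<Rightarrow> 'a measure \<Rightarrow> 'a measure"
    (infixl \<open>\<^bold>*\<close> 70) where
  "\<mu> \<^bold>* \<nu> = distr (\<mu> \<Otimes>\<^sub>M \<nu>) borel (\<lambda>(x, y). x + y)"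

abbreviation degenerate :: "'a::topological_space \<Rightarrow> 'a measure" where
  "degenerate x \<equiv> return borel x"

definition prob_on :: "'a::topological_space set \<Rightarrow> 'a measure set" where
  "prob_on H = {\<mu>. prob_space \<mu> \<and> sets \<mu> = sets borel \<and> measure \<mu> H = 1}"

text \<open>The value of the character \<open>(s, n) \<in> \<real> \<times> \<int>\<close> at \<open>(t, z) \<in> X\<close> is \<open>e\<^sup>i\<^sup>t\<^sup>s z\<^sup>n\<close>.\<close>

definition char_X :: "X measure \<Rightarrow> real \<times> int \<Rightarrow> complex" where
  "char_X \<mu> = (\<lambda>(s, n). LINT (t, z)|\<mu>. cis (t * s) * complex_of_circle z powi n)"

definition subgroup_G :: "X set" where
  "subgroup_G = {(0, circle_of_complex 1), (0, circle_of_complex (-1))}"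

definition m_G :: "X measure" where
  "m_G = distr (measure_pmf (pmf_of_set subgroup_G)) borel (\<lambda>x. x)"

text \<open>The automorphism with matrix rows \<open>(a, b)\<close> and \<open>(0, 1)\<close>.\<close>

definition alpha :: "real \<Rightarrow> real \<Rightarrow> X \<Rightarrow> X" where
  "alpha a b = (\<lambda>(t, z). (a * t, circle_of_complex (cis (b * t) * complex_of_circle z)))"

section \<open>The group \<open>\<real> \<times> \<int>(2)\<close>\<close>

definition minus_one_power :: "bit \<Rightarrow> complex" where
  "minus_one_power k = (if k = 0 then 1 else - 1)"

definition tau :: "real \<Rightarrow> real \<Rightarrow> real \<times> bit \<Rightarrow> X" where
  "tau a b = (\<lambda>(t, k). (t, circle_of_complex (minus_one_power k * cis (b * t / (a - 1)))))"

definition subgroup_F :: "real \<Rightarrow> real \<Rightarrow> X set" where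
  "subgroup_F a b = tau a b ` (UNIV \<times> {0})"

definition F_times_G :: "real \<Rightarrow> real \<Rightarrow> X set" where
  "F_times_G a b = {x + g | x g. x \<in> subgroup_F a b \<and> g \<in> subgroup_G}"

definition borel_R_Z2 :: "(real \<times> bit) measure" where
  "borel_R_Z2 = borel \<Otimes>\<^sub>M count_space UNIV"

definition prob_R_Z2 :: "(real \<times> bit) measure set" where
  "prob_R_Z2 = {M. prob_space M \<and> sets M = sets borel_R_Z2}"

text \<open>\<open>minus_one_power (k * l)\<close> is \<open>(-1)\<^sup>k\<^sup>l\<close>, since \<open>bit\<close> is the field with two elements.\<close>

definition char_R_Z2 :: "(real \<times> bit) measure \<Rightarrow> real \<times> bit \<Rightarrow> complex" where
  "char_R_Z2 M = (\<lambda>(s, l). LINT (t, k)|M. cis (t * s) * minus_one_power (k * l))"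

text \<open>Degenerate Gaussian distributions are treated separately, because \<open>normal_density m 0\<close> is
  not a probability density.\<close>

definition gaussian :: "real measure set" where
  "gaussian = {return borel m | m. True} \<union>
     {density lborel (\<lambda>x. ennreal (normal_density m \<sigma> x)) | m \<sigma>. \<sigma> > 0}"

definition gaussian_F :: "real \<Rightarrow> real \<Rightarrow> X measure set" where
  "gaussian_F a b = (\<lambda>N. distr N borel (\<lambda>t. tau a b (t, 0))) ` gaussian"

definition Lambda_class :: "(real \<times> bit) measure set" where
  "Lambda_class = {M \<in> prob_R_Z2. distr M borel fst \<in> gaussian}"

definition Theta_class :: "(real \<times> bit) measure set" where
  "Theta_class = {M \<in> prob_R_Z2.
     \<exists>\<sigma> \<sigma>' \<beta> \<beta>' \<kappa> :: real. \<sigma> \<ge> 0 \<and> \<sigma>' \<ge> 0 \<and>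
       (\<forall>s. char_R_Z2 M (s, 0) = exp (complex_of_real (- \<sigma> * s\<^sup>2) + \<i> * complex_of_real (\<beta> * s))) \<and>
       (\<forall>s. char_R_Z2 M (s, 1) =
          complex_of_real \<kappa> * exp (complex_of_real (- \<sigma>' * s\<^sup>2) + \<i> * complex_of_real (\<beta>' * s))) \<and>
       ((0 < \<sigma>' \<and> \<sigma>' < \<sigma> \<and> 0 < \<bar>\<kappa>\<bar> \<and>
         \<bar>\<kappa>\<bar> \<le> sqrt (\<sigma>' / \<sigma>) * exp (- ((\<beta> - \<beta>')\<^sup>2 / (4 * (\<sigma> - \<sigma>')))))
        \<or> (\<sigma> = \<sigma>' \<and> \<beta> = \<beta>' \<and> \<bar>\<kappa>\<bar> \<le> 1))}"

text \<open>The conditional distribution of \<open>L\<^sub>2\<close> given \<open>L\<^sub>1\<close> is symmetric iff \<open>(L\<^sub>1, L\<^sub>2)\<close> and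
  \<open>(L\<^sub>1, - L\<^sub>2)\<close> are identically distributed.\<close>

definition cond_symmetric ::
    "'p measure \<Rightarrow> ('p \<Rightarrow> 'a::{topological_space, uminus}) \<Rightarrow> ('p \<Rightarrow> 'a) \<Rightarrow> bool" where
  "cond_symmetric P L2 L1 \<longleftrightarrow>
     distr P (borel \<Otimes>\<^sub>M borel) (\<lambda>\<omega>. (L1 \<omega>, L2 \<omega>)) =
     distr P (borel \<Otimes>\<^sub>M borel) (\<lambda>\<omega>. (L1 \<omega>, - L2 \<omega>))"

end

theory Submission
  imports Defs
begin

text \<open>Symmetry of the conditional distribution is Heyde's functional equation
  \<open>f(u + v) g(u + Av) = f(u - v) g(u - Av)\<close> for the characteristic functions, where \<open>A\<close> is the
  adjoint of \<open>\<alpha>\<close>. If \<open>a \<noteq> 1\<close>, evaluating it at a fixed point \<open>u = v\<close> of \<open>A\<close> gives a character with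
  \<open>\<bar>f\<bar> = \<bar>g\<bar> = 1\<close>, which confines both distributions to cosets of \<open>\<tau>(\<real> \<times> \<int>(2))\<close> and splits the
  equation into two scalar equations \<open>f(s + t) g(s + at) = f(s - t) g(s - at)\<close> on \<open>\<real>\<close>, one for each
  character of \<open>\<int>(2)\<close>. For \<open>a \<noteq> 0, \<plusminus>1\<close> the zero-free set of a solution is open and closed, so either
  a factor vanishes identically or both are exponentials of quadratic polynomials; the two leading
  coefficients are related by \<open>\<sigma> + a \<sigma>' = 0\<close>, which forces degeneracy when \<open>a > 0\<close>. The parameter
  constraints of the class \<open>\<Theta>\<close> express that the two components of a distribution are nonnegative.\<close>

section \<open>Heyde's equation on the real line\<close>

text \<open>Taking \<open>u = v\<close> in the functional equation reaches only doubled characters,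
  here \<open>(- 2 * b / (a - 1), 2)\<close>. A constant value of that character fixes the square of
  the circle coordinate as a function of the real one; the remaining choice of a square root is the
  bit of \<real> \<times> \<int>(2), and this is where \<open>tau\<close> comes from. The component
  at the trivial character of \<int>(2) equals 1 at the origin, so it cannot vanish identically. The
  other component can, and its vanishing for one of the distributions is exactly the factor
  \<open>m_G\<close>: this separates 1a from 1b. For a = -1 the scalar equation reads
  \<open>f p * g q = f q * g p\<close>. It gives proportionality and nothing Gaussian; a real ratio
  of absolute value at most 1, in one of the two directions, is the value of a characteristic
  function on G. These already make the real coordinates degenerate, and one more evaluation bounds
  the circle coordinates.\<close>

lemma continuous_additive_real:
  fixes f :: "real \<Rightarrow> complex"
  assumes cont: "continuous_on UNIV f" and add: "\<And>x y. f (x + y) = f x + f y"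
  shows "f x = of_real x * f 1"
proof -
  interpret f: Modules.additive f by standard (rule add)
  have nat: "f (of_nat n * x) = of_nat n * f x" for n x
    by (induction n) (auto simp: f.zero add algebra_simps)
  have int: "f (of_int k * x) = of_int k * f x" for k x
    by (cases k rule: int_cases2) (auto simp: nat f.minus)
  have rat: "f r = of_real r * f 1" if "r \<in> \<rat>" for r
  proof -
    obtain p q where "r = of_int p / of_int q" and q: "q > 0"
      using \<open>r \<in> \<rat>\<close> by (metis Rats_cases')
    then have r: "of_int q * r = (of_int p :: real)" by simp
    have "of_int q * f r = f (of_int p * 1)"
      using int[of q r] r by simp
    also have "\<dots> = of_int p * f 1" by (rule int)
    also have "of_int p = (of_real (of_int q * r) :: complex)" using r by simp
    finally show ?thesis using q by simp
  qed
  have "closed {x. f x - of_real x * f 1 = 0}"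
    by (intro closed_Collect_eq continuous_intros cont)
  moreover have "\<rat> \<subseteq> {x. f x - of_real x * f 1 = 0}"
  proof
    fix r :: real assume "r \<in> \<rat>"
    then show "r \<in> {x. f x - of_real x * f 1 = 0}" by (simp only: mem_Collect_eq rat[of r] diff_self)
  qed
  ultimately have "closure \<rat> \<subseteq> {x. f x - of_real x * f 1 = 0}"
    by (rule closure_minimal[rotated])
  then show ?thesis by (auto simp: Rats_closure_real)
qed

text \<open>The mixed second difference based at 0, \<open>B h x\<close>, is additive in x by
  \<open>diff\<close> and symmetric in h and x, hence \<open>x * h * B 1 1\<close>. Subtracting half
  of \<open>B 1 1\<close> times the square leaves a continuous additive function.\<close>

lemma quadratic_if_second_differences_constant:
  fixes l :: "real \<Rightarrow> complex"
  assumes cont: "continuous_on UNIV l"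
    and diff: "\<And>x h k. l (x + h + k) - l (x + h) - l (x + k) + l x = l (h + k) - l h - l k + l 0"
  obtains c1 c2 where "\<And>x. l x = l 0 + c1 * of_real x + c2 * of_real (x\<^sup>2)"
proof -
  have cont': "continuous_on UNIV (\<lambda>x. l (g x))" if "continuous_on UNIV g" for g
    using continuous_on_compose2[OF cont that] by auto
  define B where "B h x = l (x + h) - l x - l h + l 0" for h x
  have B: "B h x = of_real x * B h 1" for h x
  proof (rule continuous_additive_real)
    show "continuous_on UNIV (B h)"
      unfolding B_def by (intro continuous_intros cont')
    show "B h (x + y) = B h x + B h y" for x y
      using diff[of x y h] by (simp add: B_def algebra_simps)
  qed
  have B1: "B h x = of_real (x * h) * B 1 1" for h x
  proof -
    have "B h 1 = B 1 h" by (simp add: B_def algebra_simps)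
    also have "\<dots> = of_real h * B 1 1" by (rule B)
    finally have "of_real x * B h 1 = of_real (x * h) * B 1 1" by simp
    then show ?thesis by (simp only: B[of h x])
  qed
  define c where "c = B 1 1"
  define m where "m x = l x - l 0 - c / 2 * of_real (x\<^sup>2)" for x
  have m: "m x = of_real x * m 1" for x
  proof (rule continuous_additive_real)
    show "continuous_on UNIV m"
      unfolding m_def by (intro continuous_intros cont')
    show "m (x + y) = m x + m y" for x y
    proof -
      have "l (x + y) = l x + l y - l 0 + of_real (x * y) * c"
        using B1[of y x] by (simp add: B_def[of y x] c_def[symmetric] algebra_simps)
      then show ?thesis
        unfolding m_def by (simp add: power2_eq_square algebra_simps add_divide_distrib del: add_0_right)
    qed
  qed
  show thesis
  proof (rule that)
    show "l x = l 0 + m 1 * of_real x + c / 2 * of_real (x\<^sup>2)" for x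
      using m[of x] by (simp add: m_def[of x] algebra_simps)
  qed
qed

text \<open>The zero-free set of \<open>f\<close> is also closed: if \<open>f p = 0\<close> with \<open>p\<close> in its closure and \<open>g q \<noteq> 0\<close>,
  the map carrying \<open>(s1 + s2, s1 + a * s2)\<close> to \<open>(s1 - s2, s1 - a * s2)\<close> sends points near \<open>(p, q)\<close>,
  with either coordinate of the image prescribed, to zero-free points.\<close>

lemma heyde_nonvanishing_aux:
  fixes f g :: "real \<Rightarrow> complex"
  assumes a: "a \<noteq> 1" "a \<noteq> -1"
    and cont: "continuous_on UNIV f" "continuous_on UNIV g"
    and eq: "\<And>s1 s2. f (s1 + s2) * g (s1 + a * s2) = f (s1 - s2) * g (s1 - a * s2)"
    and nz: "f x0 \<noteq> 0" "g q \<noteq> 0"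
  shows "f x \<noteq> 0"
proof -
  define U where "U = {x. f x \<noteq> 0}"
  have openU: "open U"
    unfolding U_def using cont(1) by (intro open_Collect_neq) auto
  have openV: "open {x. g x \<noteq> 0}"
    using cont(2) by (intro open_Collect_neq) auto
  \<comment> \<open>The arguments on the left become free variables p = s1 + s2 and r = s1 + a * s2;
    those on the right are then linear in p and r.\<close>
  have eq': "f p * g r = f (((a + 1) * p - 2 * r) / (a - 1)) * g ((2 * a * p - (a + 1) * r) / (a - 1))"
    for p r
  proof -
    define s2 where "s2 = (r - p) / (a - 1)"
    have s2: "(a - 1) * s2 = r - p" using a by (simp add: s2_def)
    have 1: "p - s2 + s2 = p" "p - s2 + a * s2 = r"
      using s2 by - algebra+
    have "(p - s2 - s2) * (a - 1) = (a + 1) * p - 2 * r"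
      "(p - s2 - a * s2) * (a - 1) = 2 * a * p - (a + 1) * r"
      using s2 by - algebra+
    then have 2: "p - s2 - s2 = ((a + 1) * p - 2 * r) / (a - 1)"
      "p - s2 - a * s2 = (2 * a * p - (a + 1) * r) / (a - 1)"
      using a by (simp_all only: nonzero_eq_divide_eq right_minus_eq not_False_eq_True)
    show ?thesis using eq[of "p - s2" s2] unfolding 1 2 .
  qed
  obtain e where e: "e > 0" "\<And>y. \<bar>y - q\<bar> < e \<Longrightarrow> g y \<noteq> 0"
    using openV nz(2) unfolding open_dist dist_real_def by auto
  have near: "\<exists>p' r'. f p' \<noteq> 0 \<and> g r' \<noteq> 0 \<and> r' - q = k * (p' - p)" if p: "p \<in> closure U" for p k
  proof -
    \<comment> \<open>The summand 1 keeps the denominator positive when k = 0.\<close>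
    obtain p' where p': "p' \<in> U" "\<bar>p' - p\<bar> < e / (\<bar>k\<bar> + 1)"
    proof -
      have "e / (\<bar>k\<bar> + 1) > 0" using e(1) by (intro divide_pos_pos) auto
      then show ?thesis using that closure_approachable[of p U] p by (auto simp: dist_real_def)
    qed
    have "\<bar>k * (p' - p)\<bar> \<le> (\<bar>k\<bar> + 1) * \<bar>p' - p\<bar>"
      by (simp add: abs_mult mult_right_mono)
    also have "\<dots> < e"
      using p'(2) by (simp add: pos_less_divide_eq mult.commute)
    finally have "g (q + k * (p' - p)) \<noteq> 0" by (intro e(2)) simp
    then show ?thesis using p'(1) by (intro exI[of _ p'] exI[of _ "q + k * (p' - p)"]) (simp add: U_def)
  qed
  have "closure U \<subseteq> U"
  proof
    fix p assume p: "p \<in> closure U"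
    \<comment> \<open>Along the slope \<open>(a + 1) / 2\<close> the value of
      \<open>(a + 1) * p - 2 * r\<close> stays the one at \<open>(p, q)\<close>; along
      \<open>2 * a / (a + 1)\<close> the same holds for \<open>2 * a * p - (a + 1) * r\<close>. Each
      auxiliary point thus certifies one factor on the right of \<open>eq'\<close> at
      \<open>(p, q)\<close>.\<close>
    obtain p1 r1 where 1: "f p1 \<noteq> 0" "g r1 \<noteq> 0" "r1 - q = (a + 1) / 2 * (p1 - p)"
      using near[OF p] by blast
    obtain p2 r2 where 2: "f p2 \<noteq> 0" "g r2 \<noteq> 0" "r2 - q = 2 * a / (a + 1) * (p2 - p)"
      using near[OF p] by blast
    have r2: "(a + 1) * (r2 - q) = 2 * a * (p2 - p)"
      using 2(3) a(2) by (simp add: field_simps)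
    have "(a + 1) * p - 2 * q = (a + 1) * p1 - 2 * r1"
      using 1(3) by (simp add: algebra_simps)
    then have "f (((a + 1) * p - 2 * q) / (a - 1)) \<noteq> 0"
      using eq'[of p1 r1] 1(1,2) by auto
    moreover have "2 * a * p - (a + 1) * q = 2 * a * p2 - (a + 1) * r2"
      using r2 by (simp add: algebra_simps)
    then have "g ((2 * a * p - (a + 1) * q) / (a - 1)) \<noteq> 0"
      using eq'[of p2 r2] 2(1,2) by auto
    ultimately show "p \<in> U"
      using eq'[of p q] by (auto simp: U_def)
  qed
  then have "closed U"
    using closure_subset_eq by blast
  then have "U = UNIV"
    using openU nz(1) clopen[of U] by (auto simp: U_def)
  then show ?thesis by (auto simp: U_def)
qed

text \<open>Replacing s2 by s2 / a exchanges the roles of f and g and turns a into 1 / a, so one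
  argument serves both functions.\<close>

lemma heyde_nonvanishing:
  fixes f g :: "real \<Rightarrow> complex"
  assumes a: "a \<noteq> 0" "a \<noteq> 1" "a \<noteq> -1"
    and cont: "continuous_on UNIV f" "continuous_on UNIV g"
    and eq: "\<And>s1 s2. f (s1 + s2) * g (s1 + a * s2) = f (s1 - s2) * g (s1 - a * s2)"
    and nz: "f p \<noteq> 0" "g q \<noteq> 0"
  shows "f x \<noteq> 0" "g x \<noteq> 0"
proof -
  show "f x \<noteq> 0"
    by (rule heyde_nonvanishing_aux[OF a(2,3) cont eq nz])
  have "g (s1 + s2) * f (s1 + 1 / a * s2) = g (s1 - s2) * f (s1 - 1 / a * s2)" for s1 s2
    using eq[of s1 "s2 / a"] a(1) by (simp add: mult.commute)
  moreover have "1 / a \<noteq> 1" "1 / a \<noteq> -1"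
    using a by (auto simp: field_simps)
  ultimately show "g x \<noteq> 0"
    using heyde_nonvanishing_aux[of "1 / a" g f] cont nz by blast
qed

lemma continuous_logarithm_real:
  fixes f :: "real \<Rightarrow> complex"
  assumes "continuous_on UNIV f" "\<And>x. f x \<noteq> 0"
  obtains l where "continuous_on UNIV l" "\<And>x. f x = exp (l x)"
  using continuous_logarithm_on_contractible[of UNIV f] assms convex_imp_contractible[of "UNIV :: real set"]
  by auto

text \<open>Adding \<open>(-a j, j)\<close> to \<open>(s1, s2)\<close> fixes \<open>s1 + a s2\<close> and adding \<open>(a i, i)\<close> fixes \<open>s1 - a s2\<close>, so these
  two differences eliminate \<open>m\<close>; what remains relates functions of the independent variables
  \<open>s1 + s2\<close> and \<open>s1 - s2\<close>.\<close>

lemma heyde_log_second_differences: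
  fixes l m :: "real \<Rightarrow> complex"
  assumes a: "a \<noteq> 1" "a \<noteq> -1"
    and eq: "\<And>s1 s2. l (s1 + s2) + m (s1 + a * s2) = l (s1 - s2) + m (s1 - a * s2)"
  shows "l (x + h + k) - l (x + h) - l (x + k) + l x = l (h + k) - l h - l k + l 0"
proof -
  define A where "A = (\<lambda>p. l (p + h + k) - l (p + h) - l (p + k) + l p)"
  define j i where "j = k / (1 - a)" and "i = h / (1 + a)"
  have jk: "j - a * j = k" and ih: "i + a * i = h"
  proof -
    have "j * (1 - a) = k" "i * (1 + a) = h" using a by (simp_all add: j_def i_def)
    then show "j - a * j = k" "i + a * i = h" by (simp_all add: right_diff_distrib distrib_left mult.commute)
  qed
  \<comment> \<open>The scaling of i and j makes s1 + s2 move by h and k under the two translations;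
    h' and k' are the moves of s1 - s2 under the same translations.\<close>
  define h' k' where "h' = (a - 1) * i" and "k' = - (a + 1) * j"
  have *: "A (s1 + s2) = l (s1 - s2 + h' + k') - l (s1 - s2 + h') - l (s1 - s2 + k') + l (s1 - s2)"
    (is "_ = ?C (s1 - s2)") for s1 s2
  proof -
    have ring: "s1 + s2 + h + k = (s1 - a * j + a * i) + (s2 + j + i)"
       "s1 + s2 + h = (s1 + a * i) + (s2 + i)" "s1 + s2 + k = (s1 - a * j) + (s2 + j)"
       "s1 - s2 + h' + k' = (s1 - a * j + a * i) - (s2 + j + i)"
       "s1 - s2 + h' = (s1 + a * i) - (s2 + i)" "s1 - s2 + k' = (s1 - a * j) - (s2 + j)"
      unfolding jk[symmetric] ih[symmetric] h'_def k'_def by (simp_all add: algebra_simps)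
    have m: "m ((s1 - a * j + a * i) + a * (s2 + j + i)) = m (s1 + a * i + a * (s2 + i))"
       "m ((s1 - a * j) + a * (s2 + j)) = m (s1 + a * s2)"
       "m ((s1 - a * j + a * i) - a * (s2 + j + i)) = m ((s1 - a * j) - a * (s2 + j))"
       "m (s1 + a * i - a * (s2 + i)) = m (s1 - a * s2)"
      by (rule arg_cong[of _ _ m], simp add: algebra_simps)+
    \<comment> \<open>The four instances of the equation enter with signs +, -, -, +. By the choice
      of the translations only four values of m occur, and each cancels.\<close>
    have lin: "p - q - r + t = p' - q' - r' + t'"
      if "p + m1 = p' + m3" "q + m1 = q' + m2" "r + m4 = r' + m3" "t + m4 = t' + m2"
      for p q r t p' q' r' t' m1 m2 m3 m4 :: complex
      using that by algebra
    show ?thesis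
      unfolding A_def unfolding ring(1,4) unfolding ring(2,3,5,6)
      using eq[of "s1 - a * j + a * i" "s2 + j + i"] eq[of "s1 + a * i" "s2 + i"]
        eq[of "s1 - a * j" "s2 + j"] eq[of s1 s2]
      unfolding m by (rule lin)
  qed
  have "A x = A 0"
    using *[of "x / 2" "x / 2"] *[of 0 0] by simp
  then show ?thesis by (simp add: A_def)
qed

text \<open>For continuous logarithms the equation holds a priori only modulo integer multiples of 2
  * pi * \<i>. The defect \<open>D\<close> is continuous on the connected plane, takes values in
  that discrete set and vanishes at the origin, so the logarithmic equation is exact.\<close>

lemma heyde_exponential_form:
  fixes f g :: "real \<Rightarrow> complex"
  assumes a: "a \<noteq> 0" "a \<noteq> 1" "a \<noteq> -1"
    and cont: "continuous_on UNIV f" "continuous_on UNIV g"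
    and eq: "\<And>s1 s2. f (s1 + s2) * g (s1 + a * s2) = f (s1 - s2) * g (s1 - a * s2)"
    and nz: "\<And>x. f x \<noteq> 0" "\<And>x. g x \<noteq> 0"
  obtains c1 c2 d1 d2 where
    "\<And>x. f x = f 0 * exp (c1 * of_real x + c2 * of_real (x\<^sup>2))"
    "\<And>x. g x = g 0 * exp (d1 * of_real x + d2 * of_real (x\<^sup>2))"
    "c2 + of_real a * d2 = 0"
proof -
  obtain l where l: "continuous_on UNIV l" "\<And>x. f x = exp (l x)"
    using continuous_logarithm_real cont(1) nz(1) by blast
  obtain m where m: "continuous_on UNIV m" "\<And>x. g x = exp (m x)"
    using continuous_logarithm_real cont(2) nz(2) by blast
  have contl: "continuous_on UNIV (\<lambda>x. l (u x))" if "continuous_on UNIV u"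
    for u :: "real \<times> real \<Rightarrow> real"
    using continuous_on_compose2[OF l(1) that] by auto
  have contm: "continuous_on UNIV (\<lambda>x. m (u x))" if "continuous_on UNIV u"
    for u :: "real \<times> real \<Rightarrow> real"
    using continuous_on_compose2[OF m(1) that] by auto
  define D where "D = (\<lambda>s. l (fst s + snd s) + m (fst s + a * snd s)
      - (l (fst s - snd s) + m (fst s - a * snd s)))"
  have D1: "exp (D s) = 1" for s
  proof -
    have "exp (l (fst s + snd s) + m (fst s + a * snd s)) = exp (l (fst s - snd s) + m (fst s - a * snd s))"
      unfolding exp_add l(2)[symmetric] m(2)[symmetric] by (rule eq)
    then show ?thesis unfolding D_def exp_diff by simp
  qed
  have "D constant_on UNIV"
  proof (rule continuous_discrete_range_constant)
    show "continuous_on UNIV D"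
      unfolding D_def by (intro continuous_intros contl contm)
    show "\<exists>e>0. \<forall>y. y \<in> UNIV \<and> D y \<noteq> D x \<longrightarrow> e \<le> norm (D y - D x)" for x
    proof (intro exI[of _ "2 * pi"] conjI allI impI)
      fix y assume y: "y \<in> UNIV \<and> D y \<noteq> D x"
      have "exp (D y - D x) = 1" by (simp add: exp_diff D1)
      then obtain n :: int where n: "Re (D y - D x) = 0" "Im (D y - D x) = of_int (2 * n) * pi"
        unfolding exp_eq_1 by auto
      have "n \<noteq> 0" using n y by (auto simp: complex_eq_iff)
      then have "1 \<le> \<bar>real_of_int n\<bar>" by linarith
      then have "2 * pi \<le> \<bar>Im (D y - D x)\<bar>" unfolding n(2) by (simp add: abs_mult)
      also have "\<dots> \<le> norm (D y - D x)" by (rule abs_Im_le_cmod)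
      finally show "2 * pi \<le> norm (D y - D x)" .
    qed simp
  qed (rule convex_connected, rule convex_UNIV)
  then have "D s = D (0, 0)" for s unfolding constant_on_def by (metis UNIV_I)
  moreover have "D (0, 0) = 0" by (simp add: D_def)
  ultimately have D0: "D s = 0" for s by metis
  have eqlm: "l (s1 + s2) + m (s1 + a * s2) = l (s1 - s2) + m (s1 - a * s2)" for s1 s2
    using D0[of "(s1, s2)"] by (simp add: D_def)
  have eqml: "m (s1 + s2) + l (s1 + 1 / a * s2) = m (s1 - s2) + l (s1 - 1 / a * s2)" for s1 s2
    using eqlm[of s1 "s2 / a"] a(1) by (simp add: add.commute)
  have a': "1 / a \<noteq> 1" "1 / a \<noteq> -1"
    using a by (auto simp: field_simps)
  obtain c1 c2 where c: "\<And>x. l x = l 0 + c1 * of_real x + c2 * of_real (x\<^sup>2)"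
    using quadratic_if_second_differences_constant[OF l(1)]
      heyde_log_second_differences[OF a(2,3) eqlm] by blast
  obtain d1 d2 where d: "\<And>x. m x = m 0 + d1 * of_real x + d2 * of_real (x\<^sup>2)"
    using quadratic_if_second_differences_constant[OF m(1)]
      heyde_log_second_differences[OF a' eqml] by blast
  \<comment> \<open>Adding the instances at (1, 1) and (-1, -1) removes the linear terms; since (1 +
    a)^2 - (1 - a)^2 = 4 * a, what is left is 8 times the relation between the leading
    coefficients.\<close>
  have "(l 0 + c1 * of_real 2 + c2 * of_real (2\<^sup>2))
      + (m 0 + d1 * of_real (1 + a) + d2 * of_real ((1 + a)\<^sup>2))
    = (l 0 + c1 * of_real 0 + c2 * of_real (0\<^sup>2)) + (m 0 + d1 * of_real (1 - a) + d2 * of_real ((1 - a)\<^sup>2))"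
    using eqlm[of 1 1] c[of 2] d[of "1 + a"] d[of "1 - a"] by simp
  moreover have "(l 0 + c1 * of_real (- 2) + c2 * of_real ((- 2)\<^sup>2))
      + (m 0 + d1 * of_real (- 1 - a) + d2 * of_real ((- 1 - a)\<^sup>2))
    = (l 0 + c1 * of_real 0 + c2 * of_real (0\<^sup>2)) + (m 0 + d1 * of_real (a - 1) + d2 * of_real ((a - 1)\<^sup>2))"
    using eqlm[of "-1" "-1"] c[of "-2"] d[of "- 1 - a"] d[of "a - 1"] by simp
  ultimately have "8 * (c2 + of_real a * d2) = 0"
    by (simp add: power2_eq_square) algebra
  then have 3: "c2 + of_real a * d2 = 0"
    by (metis mult_eq_0_iff zero_neq_numeral)
  show thesis
    by (rule that[of c1 c2 d1 d2, OF _ _ 3]; subst l m; subst c d)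
       (simp_all add: l m exp_add mult.assoc)
qed

text \<open>Hermitian symmetry makes the value at 0 real, the linear coefficient imaginary (compare
  moduli at 1 and -1) and the quadratic coefficient real (compare phases). Boundedness then fixes
  the sign of the quadratic coefficient.\<close>

lemma bounded_hermitian_exponential_form:
  fixes f :: "real \<Rightarrow> complex"
  assumes f: "\<And>x. f x = f 0 * exp (c1 * of_real x + c2 * of_real (x\<^sup>2))"
    and nz: "f 0 \<noteq> 0" and herm: "\<And>x. f (- x) = cnj (f x)" and bdd: "\<And>x. norm (f x) \<le> 1"
  obtains \<kappa> \<sigma> \<beta> :: real where "\<sigma> \<ge> 0" "c2 = of_real (- \<sigma>)" "\<kappa> \<noteq> 0" "f 0 = of_real \<kappa>"
    "\<And>x. f x = of_real \<kappa> * exp (of_real (- \<sigma> * x\<^sup>2) + \<i> * of_real (\<beta> * x))"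
proof -
  have "cnj (f 0) = f 0" using herm[of 0] by simp
  then obtain \<kappa> where k: "f 0 = of_real \<kappa>" by (metis Reals_cases Reals_cnj_iff)
  with nz have k0: "\<kappa> \<noteq> 0" by auto
  define E where "E x = exp (c1 * of_real x + c2 * of_real (x\<^sup>2))" for x
  have fE: "f x = of_real \<kappa> * E x" for x using f[of x] k by (simp add: E_def)
  have hermE: "E (- x) = cnj (E x)" for x
    using herm[of x] k0 by (simp add: fE)
  have E': "E (- x) = exp (- c1 * of_real x + c2 * of_real (x\<^sup>2))"
    "cnj (E x) = exp (cnj c1 * of_real x + cnj c2 * of_real (x\<^sup>2))" for x
    by (simp_all add: E_def exp_cnj)
  define u v where "u = Re c1" and "v = Im c2"
  have normE: "norm (E x) = exp (u * x + Re c2 * x\<^sup>2)" for x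
    by (simp add: E_def u_def)
  have u: "u = 0"
  proof -
    have "norm (E (-1)) = norm (E 1)" using hermE[of 1] by simp
    then show ?thesis unfolding normE by simp
  qed
  have v: "v = 0"
  proof -
    have "exp (2 * \<i> * of_real (v * x\<^sup>2)) = 1" for x
    proof -
      have "- c1 * of_real x + c2 * of_real (x\<^sup>2) - (cnj c1 * of_real x + cnj c2 * of_real (x\<^sup>2))
          = 2 * \<i> * of_real (v * x\<^sup>2)"
        using u by (simp add: complex_eq_iff u_def v_def algebra_simps)
      moreover have "exp (- c1 * of_real x + c2 * of_real (x\<^sup>2) - (cnj c1 * of_real x + cnj c2 * of_real (x\<^sup>2))) = 1"
        unfolding exp_diff using hermE[of x] unfolding E' by simp
      ultimately show ?thesis by simp
    qed
    note * = this
    have **: "sin (2 * v * y) = 0" if "y \<ge> 0" for y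
    proof -
      have "exp (2 * \<i> * of_real (v * (sqrt y)\<^sup>2)) = cis (2 * v * y)"
        using that by (simp add: cis_conv_exp mult_ac)
      then have "cis (2 * v * y) = 1" using *[of "sqrt y"] by simp
      then show ?thesis by (simp add: complex_eq_iff)
    qed
    show "v = 0"
    proof (rule ccontr)
      assume v0: "v \<noteq> 0"
      \<comment> \<open>At this argument the phase is pi / 2 up to sign, where the sine is 1 or
        -1.\<close>
      have "sin (2 * v * (pi / (4 * \<bar>v\<bar>))) = 0" by (rule **) simp
      moreover have "2 * v * (pi / (4 * \<bar>v\<bar>)) = sgn v * (pi / 2)"
        using v0 by (simp add: sgn_if field_simps)
      ultimately show False using v0 by (auto simp: sgn_if split: if_splits)
    qed
  qed
  define \<sigma> where "\<sigma> = - Re c2"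
  have c2: "c2 = of_real (- \<sigma>)" using v by (simp add: complex_eq_iff v_def \<sigma>_def)
  have c1: "c1 = \<i> * of_real (Im c1)" using u by (simp add: complex_eq_iff u_def)
  have "\<sigma> \<ge> 0"
  proof (rule ccontr)
    assume "\<not> \<sigma> \<ge> 0"
    then have r: "Re c2 > 0" by (simp add: \<sigma>_def)
    \<comment> \<open>With this x the modulus is
      \<open>\<bar>\<kappa>\<bar> * exp (1 / \<bar>\<kappa>\<bar>)\<close>, which is at least
      \<open>\<bar>\<kappa>\<bar> + 1\<close>.\<close>
    define x where "x = sqrt ((1 / \<bar>\<kappa>\<bar>) / Re c2)"
    have "Re c2 * x\<^sup>2 = 1 / \<bar>\<kappa>\<bar>" using r by (simp add: x_def)
    then have "norm (f x) = \<bar>\<kappa>\<bar> * exp (1 / \<bar>\<kappa>\<bar>)" by (simp add: fE norm_mult normE u)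
    moreover have "\<bar>\<kappa>\<bar> * exp (1 / \<bar>\<kappa>\<bar>) \<ge> \<bar>\<kappa>\<bar> * (1 + 1 / \<bar>\<kappa>\<bar>)"
      by (intro mult_left_mono exp_ge_add_one_self) auto
    moreover have "\<bar>\<kappa>\<bar> * (1 + 1 / \<bar>\<kappa>\<bar>) > 1" using k0 by (simp add: algebra_simps)
    ultimately show False using bdd[of x] by linarith
  qed
  moreover have "f x = of_real \<kappa> * exp (of_real (- \<sigma> * x\<^sup>2) + \<i> * of_real (Im c1 * x))" for x
    unfolding fE E_def c2 by (subst c1) (simp add: algebra_simps)
  ultimately show thesis using that c2 k0 k by blast
qed

section \<open>Characters of \<open>\<real> \<times> \<T>\<close>\<close>

lemma complex_of_circle_inverse [simp]:
  "norm w = 1 \<Longrightarrow> complex_of_circle (circle_of_complex w) = w"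
  by (simp add: circle_of_complex_inverse)

lemma norm_complex_of_circle [simp]: "norm (complex_of_circle z) = 1"
  using complex_of_circle[of z] by simp

lemma complex_of_circle_nonzero [simp]: "complex_of_circle z \<noteq> 0"
  by (metis norm_complex_of_circle norm_zero zero_neq_one)

lemma continuous_on_complex_of_circle:
  "continuous_on S f \<Longrightarrow> continuous_on S (\<lambda>x. complex_of_circle (f x))"
  unfolding continuous_on_def by (auto intro: tendsto_complex_of_circle)

lemma continuous_on_circle_of_complex:
  "continuous_on S f \<Longrightarrow> (\<And>x. norm (f x) = 1) \<Longrightarrow> continuous_on S (\<lambda>x. circle_of_complex (f x))"
  unfolding continuous_on_def by (auto simp: tendsto_circle_iff)

definition chi :: "real \<times> int \<Rightarrow> X \<Rightarrow> complex" where
  "chi y x = cis (fst x * fst y) * complex_of_circle (snd x) powi snd y"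

lemma char_X_chi: "char_X \<mu> y = (LINT x|\<mu>. chi y x)"
  by (cases y) (simp add: char_X_def chi_def case_prod_unfold)

lemma chi_add: "chi y (x + x') = chi y x * chi y x'"
  by (simp add: chi_def plus_circle.rep_eq power_int_mult_distrib distrib_right cis_mult[symmetric])

lemma chi_add_character: "chi (y + y') x = chi y x * chi y' x"
  by (simp add: chi_def power_int_add distrib_left cis_mult[symmetric])

lemma chi_uminus_character: "chi (- y) x = chi y (- x)"
  by (simp add: chi_def uminus_circle.rep_eq power_int_minus power_int_inverse)

lemma chi_alpha: "chi (s, n) (alpha a b x) = chi (a * s + b * of_int n, n) x"
proof -
  have "cis r powi n = cis (of_int n * r)" for r
    by (rule cis_power_int)
  then show ?thesis
    by (simp add: chi_def alpha_def case_prod_unfold norm_mult power_int_mult_distrib distrib_left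
        cis_mult[symmetric] mult_ac)
qed

lemma norm_chi [simp]: "norm (chi y x) = 1"
  by (simp add: chi_def norm_mult norm_power_int)

lemma continuous_on_chi: "continuous_on UNIV (chi y)"
  unfolding chi_def cis_conv_exp
  by (intro continuous_intros continuous_on_complex_of_circle) auto

lemma measurable_chi [measurable]: "chi y \<in> borel_measurable borel"
  by (rule borel_measurable_continuous_onI[OF continuous_on_chi])

lemma measurable_alpha [measurable]: "alpha a b \<in> borel_measurable borel"
  unfolding alpha_def case_prod_unfold cis_conv_exp
  by (intro borel_measurable_continuous_onI continuous_intros continuous_on_complex_of_circle
      continuous_on_circle_of_complex) (auto simp: norm_mult)

text \<open>Symmetry lets L2 be replaced by - L2 in the expectation of
  \<open>chi u L1 * chi v L2\<close>. Regrouping the characters by variables, with \<open>w\<close>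
  the adjoint image of \<open>v\<close>, independence factors both expectations.\<close>

lemma heyde_equation:
  fixes P :: "'p measure" and \<xi>1 \<xi>2 :: "'p \<Rightarrow> X"
  assumes "prob_space P" and indep: "prob_space.indep_var P borel \<xi>1 borel \<xi>2"
    and sym: "cond_symmetric P (\<lambda>\<omega>. \<xi>1 \<omega> + alpha a b (\<xi>2 \<omega>)) (\<lambda>\<omega>. \<xi>1 \<omega> + \<xi>2 \<omega>)"
  shows "char_X (distr P borel \<xi>1) (s1 + s2, n1 + n2) *
      char_X (distr P borel \<xi>2) (s1 + (a * s2 + b * of_int n2), n1 + n2) =
    char_X (distr P borel \<xi>1) (s1 - s2, n1 - n2) *
      char_X (distr P borel \<xi>2) (s1 - (a * s2 + b * of_int n2), n1 - n2)"
proof -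
  interpret prob_space P by fact
  have [measurable]: "\<xi>1 \<in> borel_measurable P" "\<xi>2 \<in> borel_measurable P"
    using indep_var_rv1[OF indep] indep_var_rv2[OF indep] by auto
  define u v w where "u = (s1, n1)" and "v = (s2, n2)" and "w = (a * s2 + b * of_int n2, n2)"
  define L1 L2 where "L1 = (\<lambda>\<omega>. \<xi>1 \<omega> + \<xi>2 \<omega>)" and "L2 = (\<lambda>\<omega>. \<xi>1 \<omega> + alpha a b (\<xi>2 \<omega>))"
  have [measurable]: "(uminus :: X \<Rightarrow> X) \<in> borel_measurable borel"
    by (intro borel_measurable_continuous_onI continuous_intros)
  have [measurable]: "L1 \<in> borel_measurable P" "L2 \<in> borel_measurable P"
    unfolding L1_def L2_def by measurable
  have expect: "expectation (\<lambda>\<omega>. chi y (\<xi>1 \<omega>) * chi y' (\<xi>2 \<omega>)) =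
      char_X (distr P borel \<xi>1) y * char_X (distr P borel \<xi>2) y'" for y y'
  proof -
    have "expectation (\<lambda>\<omega>. chi y (\<xi>1 \<omega>) * chi y' (\<xi>2 \<omega>)) =
        expectation (\<lambda>\<omega>. chi y (\<xi>1 \<omega>)) * expectation (\<lambda>\<omega>. chi y' (\<xi>2 \<omega>))"
    proof (rule indep_var_lebesgue_integral)
      show "indep_var borel (\<lambda>\<omega>. chi y (\<xi>1 \<omega>)) borel (\<lambda>\<omega>. chi y' (\<xi>2 \<omega>))"
        using indep_var_compose[OF indep, of "chi y" borel "chi y'" borel] by (simp add: comp_def)
      show "integrable P (\<lambda>\<omega>. chi y (\<xi>1 \<omega>))" "integrable P (\<lambda>\<omega>. chi y' (\<xi>2 \<omega>))"
        by (rule integrable_const_bound[of _ 1]; simp)+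
    qed
    then show ?thesis by (simp add: char_X_chi integral_distr)
  qed
  have chi_L: "chi u (L1 \<omega>) * chi v (L2 \<omega>) = chi (u + v) (\<xi>1 \<omega>) * chi (u + w) (\<xi>2 \<omega>)"
    "chi u (L1 \<omega>) * chi v (- L2 \<omega>) = chi (u - v) (\<xi>1 \<omega>) * chi (u - w) (\<xi>2 \<omega>)" for \<omega>
  proof -
    have "chi v (alpha a b x) = chi w x" for x
      by (simp add: v_def w_def chi_alpha)
    moreover have "chi (- v) (alpha a b x) = chi (- w) x" for x
      using chi_alpha[of "- s2" "- n2" a b x] by (simp add: v_def w_def uminus_prod_def)
    ultimately show "chi u (L1 \<omega>) * chi v (L2 \<omega>) = chi (u + v) (\<xi>1 \<omega>) * chi (u + w) (\<xi>2 \<omega>)"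
      "chi u (L1 \<omega>) * chi v (- L2 \<omega>) = chi (u - v) (\<xi>1 \<omega>) * chi (u - w) (\<xi>2 \<omega>)"
      unfolding chi_uminus_character[symmetric] diff_conv_add_uminus
      by (simp_all add: L1_def L2_def chi_add chi_add_character mult_ac del: add_uminus_conv_diff)
  qed
  have "expectation (\<lambda>\<omega>. chi u (L1 \<omega>) * chi v (L2 \<omega>)) =
      (LINT x|distr P (borel \<Otimes>\<^sub>M borel) (\<lambda>\<omega>. (L1 \<omega>, L2 \<omega>)). chi u (fst x) * chi v (snd x))"
    by (subst integral_distr) simp_all
  also have "distr P (borel \<Otimes>\<^sub>M borel) (\<lambda>\<omega>. (L1 \<omega>, L2 \<omega>)) = distr P (borel \<Otimes>\<^sub>M borel) (\<lambda>\<omega>. (L1 \<omega>, - L2 \<omega>))"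
    using sym by (simp add: cond_symmetric_def L1_def L2_def)
  also have "(LINT x|\<dots>. chi u (fst x) * chi v (snd x)) = expectation (\<lambda>\<omega>. chi u (L1 \<omega>) * chi v (- L2 \<omega>))"
    by (subst integral_distr) simp_all
  finally show ?thesis
    unfolding chi_L expect by (simp add: u_def v_def w_def)
qed

text \<open>Equality case of the triangle inequality: for a mean c of modulus 1, the squared
  distance \<open>2 - 2 * Re (cnj c * f x)\<close> is nonnegative and has expectation 0.\<close>

lemma (in prob_space) AE_eq_expectation_if_norm_1:
  fixes f :: "'a \<Rightarrow> complex"
  assumes [measurable]: "f \<in> borel_measurable M" and f: "\<And>x. norm (f x) = 1"
    and E: "norm (expectation f) = 1"
  shows "AE x in M. f x = expectation f"
proof -
  define c where "c = expectation f"
  have int: "integrable M f" by (rule integrable_const_bound[of _ 1]) (auto simp: f)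
  have eq: "(norm (f x - c))\<^sup>2 = 2 - 2 * Re (cnj c * f x)" for x
  proof -
    have "(norm (f x - c))\<^sup>2 = (norm (f x))\<^sup>2 + (norm c)\<^sup>2 - 2 * Re (cnj c * f x)"
      unfolding cmod_power2 by (simp add: power2_eq_square algebra_simps)
    then show ?thesis using f[of x] E by (simp add: c_def)
  qed
  have intc: "integrable M (\<lambda>x. cnj c * f x)" using int by simp
  then have intR: "integrable M (\<lambda>x. Re (cnj c * f x))" by (rule integrable_Re)
  then have int2: "integrable M (\<lambda>x. (norm (f x - c))\<^sup>2)"
    unfolding eq by (intro Bochner_Integration.integrable_diff integrable_mult_right) simp_all
  have "cnj c * c = 1"
    using E by (metis c_def complex_norm_square mult.commute of_real_1 one_power2)
  then have "expectation (\<lambda>x. cnj c * f x) = 1" using int by (simp add: c_def)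
  then have "expectation (\<lambda>x. Re (cnj c * f x)) = 1"
    using integral_Re[OF intc] by simp
  then have "expectation (\<lambda>x. (norm (f x - c))\<^sup>2) = 0"
    unfolding eq using intR
    by (subst Bochner_Integration.integral_diff) (simp_all only: integrable_const integrable_mult_right
        integral_mult_right_zero lebesgue_integral_const prob_space, simp)
  then have "AE x in M. (norm (f x - c))\<^sup>2 = 0"
    using integral_nonneg_eq_0_iff_AE[OF int2] by simp
  then show ?thesis by (simp add: c_def)
qed

section \<open>Shifts, and distributions carried by a coset of the image of
  \<open>tau\<close>\<close>

lemma convol_degenerate:
  fixes \<mu> :: "'a::{second_countable_topology, topological_monoid_add} measure"
  assumes "prob_space \<mu>" and sets [measurable_cong]: "sets \<mu> = sets borel"
  shows "\<mu> \<^bold>* degenerate x = distr \<mu> borel (\<lambda>y. y + x)"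
proof -
  interpret prob_space \<mu> by fact
  interpret D: prob_space "degenerate x" by (rule prob_space_return) simp
  have "\<mu> \<Otimes>\<^sub>M degenerate x = distr \<mu> (\<mu> \<Otimes>\<^sub>M degenerate x) (\<lambda>y. (y, x))"
  proof (rule pair_measure_eqI)
    fix A B assume A: "A \<in> sets \<mu>" and "B \<in> sets (degenerate x)"
    then have B: "B \<in> sets borel" by simp
    have "(\<lambda>y. (y, x)) -` (A \<times> B) \<inter> space \<mu> = (if x \<in> B then A else {})"
      using sets.sets_into_space[OF A] by auto
    then show "emeasure \<mu> A * emeasure (degenerate x) B =
        emeasure (distr \<mu> (\<mu> \<Otimes>\<^sub>M degenerate x) (\<lambda>y. (y, x))) (A \<times> B)"
      using A B by (subst emeasure_distr) (auto simp: indicator_def intro!: pair_measureI)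
  qed (auto intro: sigma_finite_measure_axioms D.sigma_finite_measure_axioms)
  then have "\<mu> \<^bold>* degenerate x = distr (distr \<mu> (\<mu> \<Otimes>\<^sub>M degenerate x) (\<lambda>y. (y, x))) borel (\<lambda>(x, y). x + y)"
    by (simp add: convol_def)
  also have "\<dots> = distr \<mu> borel (\<lambda>y. y + x)"
  proof (subst distr_distr)
    have "(\<lambda>(x, y). x + y) \<in> borel_measurable (borel \<Otimes>\<^sub>M (borel :: 'a measure))"
      by measurable
    then show "(\<lambda>(x, y). x + y) \<in> borel_measurable (\<mu> \<Otimes>\<^sub>M degenerate x)"
      by (simp cong: measurable_cong_sets add: sets sets_pair_measure_cong[OF sets sets_return])
  qed (auto simp: comp_def)
  finally show ?thesis .
qed

lemma minus_one_power_simps [simp]: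
  "minus_one_power 0 = 1" "minus_one_power 1 = -1" "norm (minus_one_power k) = 1"
  by (auto simp: minus_one_power_def)

lemma minus_one_power_add: "minus_one_power (k + l) = minus_one_power k * minus_one_power l"
  by (cases k; cases l) simp_all

lemma sets_prob_R_Z2: "N \<in> prob_R_Z2 \<Longrightarrow> sets N = sets (borel \<Otimes>\<^sub>M count_space UNIV)"
  by (simp add: prob_R_Z2_def borel_R_Z2_def)

lemma prob_space_prob_R_Z2: "N \<in> prob_R_Z2 \<Longrightarrow> prob_space N"
  by (simp add: prob_R_Z2_def)

lemma measurable_tau [measurable]: "tau a b \<in> borel_measurable (borel \<Otimes>\<^sub>M count_space UNIV)"
proof -
  have "tau a b (t, k) = (t, circle_of_complex (cis (b * t / (a - 1)))) +
      (0, circle_of_complex (minus_one_power k))" for t k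
    by (simp add: tau_def complex_of_circle_inject[symmetric] plus_circle.rep_eq norm_mult mult.commute)
  then have tau: "tau a b = (\<lambda>p. (fst p, circle_of_complex (cis (b * fst p / (a - 1)))) +
      (0, circle_of_complex (minus_one_power (snd p))))"
    by (auto simp: fun_eq_iff)
  have [measurable]: "(\<lambda>t. (t, circle_of_complex (cis (b * t / (a - 1)))) :: X) \<in> borel_measurable borel"
  proof (rule borel_measurable_continuous_onI)
    show "continuous_on UNIV (\<lambda>t. (t, circle_of_complex (cis (b * t / (a - 1)))) :: X)"
      \<comment> \<open>For a = 1 the quotient is 0 by convention, so the phase is constant.\<close>
      unfolding cis_conv_exp by (cases "a = 1") (auto intro!: continuous_intros continuous_on_circle_of_complex)
  qed
  have [measurable]: "(\<lambda>k. (0, circle_of_complex (minus_one_power k)) :: X) \<in> borel_measurable (count_space UNIV)"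
    by simp
  show ?thesis unfolding tau by measurable
qed

text \<open>Constancy of this character says that the square of the circle coordinate is d times the
  square of \<open>cis (b * t / (a - 1))\<close>. Hence the coordinate is, up to sign, a fixed
  square root of d times that phase: the sign becomes the bit and the square root becomes the shift
  e.\<close>

lemma tau_representation:
  fixes \<mu> :: "X measure"
  assumes "prob_space \<mu>" and sets [measurable_cong]: "sets \<mu> = sets borel"
    and AE: "AE x in \<mu>. chi (- 2 * b / (a - 1), 2) x = d"
  obtains e N where "N \<in> prob_R_Z2" "\<mu> = distr N borel (tau a b) \<^bold>* degenerate (0, e)"
proof -
  interpret prob_space \<mu> by fact
  define c where "c = b / (a - 1)"
  have "\<exists>x. chi (- 2 * b / (a - 1), 2) x = d"
  proof (rule ccontr)
    assume *: "\<not> ?thesis"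
    have "AE x in \<mu>. False" using AE by eventually_elim (use * in blast)
    then show False by simp
  qed
  then obtain x where "chi (- 2 * b / (a - 1), 2) x = d" ..
  then have "norm d = 1" by (metis norm_chi)
  define e where "e = circle_of_complex (csqrt d)"
  have e: "complex_of_circle e = csqrt d"
    using \<open>norm d = 1\<close> by (simp add: e_def)
  \<comment> \<open>Q is the branch with sign +1, so \<open>\<rho>\<close> reads off the bit and
    inverts the shifted \<open>tau\<close> almost everywhere.\<close>
  define Q where "Q = {x :: X. complex_of_circle (snd x) = csqrt d * cis (c * fst x)}"
  define \<rho> :: "X \<Rightarrow> real \<times> bit" where "\<rho> x = (fst x, if x \<in> Q then 0 else 1)" for x
  have "closed Q"
    unfolding Q_def cis_conv_exp
    by (intro closed_Collect_eq continuous_intros continuous_on_complex_of_circle)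
  then have [measurable]: "Q \<in> sets borel" by simp
  have \<rho> [measurable]: "\<rho> \<in> borel \<rightarrow>\<^sub>M borel \<Otimes>\<^sub>M count_space UNIV"
    unfolding \<rho>_def
  proof (intro measurable_Pair)
    show "(\<lambda>x :: X. fst x) \<in> borel_measurable borel"
      by (intro borel_measurable_continuous_onI continuous_intros)
    show "(\<lambda>x. if x \<in> Q then 0 else 1 :: bit) \<in> borel \<rightarrow>\<^sub>M count_space UNIV"
      by (rule measurable_If) simp_all
  qed
  define N where "N = distr \<mu> (borel \<Otimes>\<^sub>M count_space UNIV) \<rho>"
  have N: "N \<in> prob_R_Z2"
    by (auto simp: prob_R_Z2_def borel_R_Z2_def N_def intro!: prob_space_distr)
  have "AE x in \<mu>. x = tau a b (\<rho> x) + (0, e)"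
    using AE
  proof (eventually_elim)
    fix x assume "chi (- 2 * b / (a - 1), 2) x = d"
    then have "cis (- 2 * (c * fst x)) * (complex_of_circle (snd x))\<^sup>2 = d"
      by (simp add: chi_def c_def mult_ac)
    moreover have "(cis (c * fst x))\<^sup>2 * cis (- 2 * (c * fst x)) = 1"
      by (simp only: power2_eq_square cis_mult) simp
    ultimately have "(complex_of_circle (snd x))\<^sup>2 = (csqrt d * cis (c * fst x))\<^sup>2"
      by (auto simp: power_mult_distrib mult_ac)
    then have "complex_of_circle (snd x) = csqrt d * cis (c * fst x) \<or>
        complex_of_circle (snd x) = - (csqrt d * cis (c * fst x))"
      by (simp only: power2_eq_iff)
    then have "complex_of_circle (snd x) =
        minus_one_power (if x \<in> Q then 0 else 1) * cis (c * fst x) * csqrt d"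
      by (auto simp: Q_def)
    then show "x = tau a b (\<rho> x) + (0, e)"
      by (simp add: prod_eq_iff tau_def \<rho>_def plus_circle.rep_eq e norm_mult c_def
          flip: complex_of_circle_inject)
  qed
  then have "distr \<mu> borel (\<lambda>x. x) = distr \<mu> borel (\<lambda>x. tau a b (\<rho> x) + (0, e))"
    by (intro distr_cong_AE) auto
  then have "\<mu> = distr \<mu> borel (\<lambda>x. tau a b (\<rho> x) + (0, e))"
    using sets by (simp add: distr_id2)
  also have "\<dots> = distr (distr N borel (tau a b)) borel (\<lambda>x. x + (0, e))"
    unfolding N_def by (simp add: distr_distr comp_def)
  also have "\<dots> = distr N borel (tau a b) \<^bold>* degenerate (0, e)"
    by (rule convol_degenerate[symmetric]) (auto simp: N_def intro!: prob_space.prob_space_distr prob_space_distr)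
  finally show thesis using that[OF N] by blast
qed

section \<open>Distributions on \<open>\<real> \<times> \<int>(2)\<close>\<close>

definition psi :: "real \<times> bit \<Rightarrow> real \<times> bit \<Rightarrow> complex" where
  "psi y x = cis (fst x * fst y) * minus_one_power (snd x * snd y)"

lemma char_R_Z2_psi: "char_R_Z2 N y = (LINT x|N. psi y x)"
  by (cases y) (simp add: char_R_Z2_def psi_def case_prod_unfold)

lemma norm_psi [simp]: "norm (psi y x) = 1"
  by (simp add: psi_def norm_mult)

lemma measurable_psi [measurable]: "psi y \<in> borel_measurable (borel \<Otimes>\<^sub>M count_space UNIV)"
proof -
  have [measurable]: "cis \<in> borel_measurable borel"
    unfolding cis_conv_exp by (intro borel_measurable_continuous_onI continuous_intros)
  have "(\<lambda>k. minus_one_power (k * snd y)) \<in> borel_measurable (count_space UNIV)" by simp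
  from measurable_compose[OF measurable_snd this]
  have [measurable]: "(\<lambda>x. minus_one_power (snd x * snd y)) \<in> borel_measurable (borel \<Otimes>\<^sub>M count_space UNIV)" .
  show ?thesis unfolding psi_def by measurable
qed

lemma psi_uminus: "psi (- s, l) x = cnj (psi (s, l) x)"
  by (simp add: psi_def cis_cnj minus_one_power_def)

lemma char_R_Z2_zero: "N \<in> prob_R_Z2 \<Longrightarrow> char_R_Z2 N (0, 0) = 1"
  by (simp add: char_R_Z2_psi psi_def prob_space.prob_space prob_space_prob_R_Z2)

lemma norm_char_R_Z2_le:
  assumes "N \<in> prob_R_Z2" shows "norm (char_R_Z2 N y) \<le> 1"
proof -
  interpret prob_space N using assms by (rule prob_space_prob_R_Z2)
  have "norm (char_R_Z2 N y) \<le> expectation (\<lambda>x. norm (psi y x))"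
    unfolding char_R_Z2_psi by (rule integral_norm_bound)
  then show ?thesis by (simp add: prob_space)
qed

lemma integrable_psi: "N \<in> prob_R_Z2 \<Longrightarrow> integrable N (psi y)"
  by (rule finite_measure.integrable_const_bound[of _ _ 1])
    (auto simp: prob_space.finite_measure prob_space_prob_R_Z2 cong: measurable_cong_sets[OF sets_prob_R_Z2 refl])

lemma char_R_Z2_uminus: "char_R_Z2 N (- s, l) = cnj (char_R_Z2 N (s, l))"
  unfolding char_R_Z2_psi psi_uminus by simp

lemma continuous_on_char_R_Z2:
  assumes N: "N \<in> prob_R_Z2" shows "continuous_on UNIV (\<lambda>s. char_R_Z2 N (s, l))"
proof -
  interpret prob_space N using N by (rule prob_space_prob_R_Z2)
  note [measurable_cong] = sets_prob_R_Z2[OF N]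
  have "(\<lambda>n. char_R_Z2 N (X n, l)) \<longlonglongrightarrow> char_R_Z2 N (s, l)" if "X \<longlonglongrightarrow> s" for X s
    unfolding char_R_Z2_psi
  proof (rule integral_dominated_convergence[where w = "\<lambda>_. 1"])
    show "AE x in N. (\<lambda>n. psi (X n, l) x) \<longlonglongrightarrow> psi (s, l) x"
      unfolding psi_def cis_conv_exp using that by (intro AE_I2) (auto intro!: tendsto_intros)
  qed simp_all
  then show ?thesis
    by (auto simp: continuous_on_sequentially comp_def)
qed

text \<open>The n-th power of the phase of \<open>tau\<close> shifts the real frequency by
  \<open>b / (a - 1) * n\<close>, while the n-th power of the sign depends only on the parity of
  n.\<close>

lemma char_X_tau:
  assumes N: "N \<in> prob_R_Z2"
  shows "char_X (distr N borel (tau a b) \<^bold>* degenerate x) (s, n) =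
    chi (s, n) x * char_R_Z2 N (s + b / (a - 1) * of_int n, if even n then 0 else 1)"
proof -
  interpret prob_space N using N by (rule prob_space_prob_R_Z2)
  note [measurable_cong] = sets_prob_R_Z2[OF N]
  have tau: "chi (s, n) (tau a b p) = psi (s + b / (a - 1) * of_int n, if even n then 0 else 1) p" for p
  proof -
    have "cis r powi n = cis (of_int n * r)" for r by (rule cis_power_int)
    moreover have "minus_one_power k powi n = minus_one_power (k * (if even n then 0 else 1))" for k
      by (cases k) (auto simp: power_int_minus_left)
    ultimately show ?thesis
      by (simp add: chi_def tau_def psi_def case_prod_unfold norm_mult power_int_mult_distrib
          distrib_left cis_mult[symmetric] mult_ac del: cis_mult)
  qed
  have "char_X (distr N borel (tau a b) \<^bold>* degenerate x) (s, n) = expectation (\<lambda>p. chi (s, n) (tau a b p + x))"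
    by (subst convol_degenerate) (auto simp: char_X_chi integral_distr intro!: prob_space_distr)
  also have "\<dots> = char_R_Z2 N (s + b / (a - 1) * of_int n, if even n then 0 else 1) * chi (s, n) x"
    by (simp add: chi_add tau char_R_Z2_psi)
  finally show ?thesis by (simp add: mult.commute)
qed

text \<open>Sending \<open>\<real> \<times> {k}\<close> to \<open>\<real>\<close> and the other line to a point \<open>c\<close> reduces uniqueness to the
  real line; the point \<open>c\<close> is chosen outside the Borel set to be measured.\<close>

lemma char_R_Z2_uniqueness:
  assumes N: "N \<in> prob_R_Z2" "N' \<in> prob_R_Z2" and eq: "\<And>y. char_R_Z2 N y = char_R_Z2 N' y"
  shows "N = N'"
proof -
  define h :: "bit \<Rightarrow> real \<Rightarrow> real \<times> bit \<Rightarrow> real"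
    where "h k c = (\<lambda>p. if snd p = k then fst p else c)" for k c
  have h [measurable]: "h k c \<in> borel_measurable (borel \<Otimes>\<^sub>M count_space UNIV)" for k c
    unfolding h_def by measurable
  have char_h: "char (distr M borel (h k c)) s =
      (char_R_Z2 M (s, 0) + minus_one_power k * char_R_Z2 M (s, 1)) / 2 +
      iexp (s * c) * (1 - minus_one_power k * char_R_Z2 M (0, 1)) / 2"
    if M: "M \<in> prob_R_Z2" for M k c s
  proof -
    interpret prob_space M using M by (rule prob_space_prob_R_Z2)
    note [measurable_cong] = sets_prob_R_Z2[OF M]
    note int = integrable_psi[OF M]
    have "char (distr M borel (h k c)) s = expectation (\<lambda>p. iexp (s * h k c p))"
      by (simp add: char_def integral_distr)
    also have "(\<lambda>p. iexp (s * h k c p)) = (\<lambda>p. (psi (s, 0) p + minus_one_power k * psi (s, 1) p) / 2 +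
        iexp (s * c) * (1 - minus_one_power k * psi (0, 1) p) / 2)"
    proof
      fix p
      show "iexp (s * h k c p) = (psi (s, 0) p + minus_one_power k * psi (s, 1) p) / 2 +
        iexp (s * c) * (1 - minus_one_power k * psi (0, 1) p) / 2"
        by (cases k; cases "snd p") (auto simp: h_def psi_def cis_conv_exp mult.commute)
    qed
    also have "expectation \<dots> = (char_R_Z2 M (s, 0) + minus_one_power k * char_R_Z2 M (s, 1)) / 2 +
      iexp (s * c) * (1 - minus_one_power k * char_R_Z2 M (0, 1)) / 2"
      using int by (simp add: char_R_Z2_psi prob_space)
    finally show ?thesis .
  qed
  have distr_h: "distr N borel (h k c) = distr N' borel (h k c)" for k c
  proof (rule Levy_uniqueness)
    show "real_distribution (distr N borel (h k c))" "real_distribution (distr N' borel (h k c))"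
      using h N by (auto intro!: prob_space.real_distribution_distr prob_space_prob_R_Z2
          cong: measurable_cong_sets[OF sets_prob_R_Z2 refl])
    show "char (distr N borel (h k c)) = char (distr N' borel (h k c))"
      using N eq by (auto simp: char_h)
  qed
  have line: "emeasure N (E \<times> {k}) = emeasure N' (E \<times> {k})"
    if E: "E \<in> sets borel" "E \<noteq> UNIV" for E k
  proof -
    obtain c where c: "c \<notin> E" using E(2) by auto
    have pre: "emeasure (distr M borel (h k c)) E = emeasure M (E \<times> {k})" if M: "M \<in> prob_R_Z2" for M
    proof -
      note [measurable_cong] = sets_prob_R_Z2[OF M]
      have "space M = UNIV" using sets_eq_imp_space_eq[OF sets_prob_R_Z2[OF M]] by (simp add: space_pair_measure)
      then have "h k c -` E \<inter> space M = E \<times> {k}"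
        using c by (auto simp: h_def split: if_splits)
      then show ?thesis using E(1) by (subst emeasure_distr) simp_all
    qed
    show ?thesis using pre N distr_h[of k c] by metis
  qed
  show "N = N'"
  proof (rule measure_eqI)
    show "sets N = sets N'" using N sets_prob_R_Z2 by metis
    fix A assume "A \<in> sets N"
    then have A: "A \<in> sets (borel \<Otimes>\<^sub>M count_space UNIV)" using sets_prob_R_Z2 N(1) by metis
    \<comment> \<open>Each line is cut at 0 because \<open>line\<close> needs a proper subset of the
      reals: a point outside the set must remain for the other line to be sent to.\<close>
    define E :: "bit \<times> bool \<Rightarrow> real set"
      where "E = (\<lambda>(k, b). (\<lambda>t. (t, k)) -` A \<inter> (if b then {0..} else {..<0}))"
    have E_sets: "E i \<in> sets borel" for i
    proof -
      have "(\<lambda>t. (t, k)) -` A \<in> sets borel" for k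
        using sets_Pair1[OF A] sets_Pair2[OF A, of k] by simp
      then show ?thesis by (cases i) (simp add: E_def)
    qed
    have E_ne: "E i \<noteq> UNIV" for i
    proof -
      have "- 1 \<notin> E i \<or> 1 \<notin> E i" by (cases i) (simp add: E_def)
      then show ?thesis by blast
    qed
    have AE: "A = (\<Union>i\<in>UNIV. E i \<times> {fst i})"
      by (auto simp: E_def) (metis linorder_not_le)
    have disj: "disjoint_family_on (\<lambda>i. E i \<times> {fst i}) UNIV"
      by (auto simp: disjoint_family_on_def E_def split: if_splits)
    have "(UNIV :: bit set) = {0, 1}" by (auto intro: bit.exhaust)
    then have "finite (UNIV :: bit set)" by (metis finite.emptyI finite.insertI)
    then have fin: "finite (UNIV :: (bit \<times> bool) set)"
      by (metis UNIV_Times_UNIV finite finite_SigmaI)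
    have "(\<Sum>i\<in>UNIV. emeasure M (E i \<times> {fst i})) = emeasure M A" if "M \<in> prob_R_Z2" for M
      unfolding AE using fin E_sets disj sets_prob_R_Z2[OF that]
      by (intro sum_emeasure) auto
    note sum_lines = this
    have "(\<Sum>i\<in>UNIV. emeasure N (E i \<times> {fst i})) = (\<Sum>i\<in>UNIV. emeasure N' (E i \<times> {fst i}))"
      by (intro sum.cong refl line E_sets E_ne)
    then show "emeasure N A = emeasure N' A"
      unfolding sum_lines[OF N(1)] sum_lines[OF N(2)] .
  qed
qed

text \<open>The distribution on \<open>G\<close> whose characteristic function is \<open>c\<close> at odd characters;
  meaningful only for \<open>\<bar>c\<bar> \<le> 1\<close>, since \<open>bernoulli_pmf\<close> truncates its parameter.\<close>

definition two_point_G :: "real \<Rightarrow> X measure" where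
  "two_point_G c = distr (measure_pmf (bernoulli_pmf ((1 - c) / 2))) borel
     (\<lambda>j. (0, circle_of_complex (if j then - 1 else 1)))"

lemma two_point_G_prob_on: "two_point_G c \<in> prob_on subgroup_G"
proof -
  have "subgroup_G \<in> sets borel"
    by (intro borel_closed finite_imp_closed) (simp add: subgroup_G_def)
  moreover have "(\<lambda>j. (0, circle_of_complex (if j then - 1 else 1))) -` subgroup_G = UNIV"
    by (auto simp: subgroup_G_def)
  ultimately show ?thesis
    by (auto simp: prob_on_def two_point_G_def measure_distr intro!: measure_pmf.prob_space_distr)
qed

lemma m_G_eq: "m_G = two_point_G 0"
proof -
  define g :: "bool \<Rightarrow> X" where "g = (\<lambda>j. (0, circle_of_complex (if j then - 1 else 1)))"
  have "inj g" by (auto simp: inj_def g_def circle_of_complex_inject)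
  moreover have "range g = subgroup_G"
    by (auto simp: g_def subgroup_G_def image_iff intro: exI[of _ True] exI[of _ False])
  ultimately have pmf: "pmf_of_set subgroup_G = map_pmf g (bernoulli_pmf (1 / 2))"
    by (simp add: bernoulli_pmf_half_conv_pmf_of_set map_pmf_of_set_inj)
  have "m_G = distr (distr (measure_pmf (bernoulli_pmf (1 / 2))) (count_space UNIV) g) borel (\<lambda>x. x)"
    by (simp add: m_G_def pmf map_pmf_rep_eq)
  also have "\<dots> = two_point_G 0"
    by (subst distr_distr) (auto simp: two_point_G_def g_def comp_def)
  finally show ?thesis .
qed

text \<open>Adding an independent Bernoulli bit multiplies the odd component by the mean c of its
  sign and leaves the even component alone. Uniqueness identifies the result with N', and
  \<open>tau\<close> turns the addition of the bit into the addition of an element of G.\<close>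

lemma tau_convol_two_point_G:
  assumes N: "N \<in> prob_R_Z2" "N' \<in> prob_R_Z2" and c: "\<bar>c\<bar> \<le> 1"
    and eq0: "\<And>s. char_R_Z2 N' (s, 0) = char_R_Z2 N (s, 0)"
    and eq1: "\<And>s. char_R_Z2 N' (s, 1) = of_real c * char_R_Z2 N (s, 1)"
  shows "distr N' borel (tau a b) = distr N borel (tau a b) \<^bold>* two_point_G c"
proof -
  interpret N: prob_space N using N(1) by (rule prob_space_prob_R_Z2)
  note [measurable_cong] = sets_prob_R_Z2[OF N(1)]
  define B where "B = measure_pmf (bernoulli_pmf ((1 - c) / 2))"
  interpret B: prob_space B unfolding B_def by (rule prob_space_measure_pmf)
  have [measurable_cong]: "sets B = sets (count_space UNIV)" by (simp add: B_def)
  interpret NB: pair_prob_space N B ..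
  define f :: "bool \<Rightarrow> bit" where "f j = (if j then 1 else 0)" for j
  define T :: "(real \<times> bit) \<times> bool \<Rightarrow> real \<times> bit"
    where "T = (\<lambda>q. (fst (fst q), snd (fst q) + f (snd q)))"
  have "(\<lambda>(k, j). k + f j) \<in> count_space UNIV \<Otimes>\<^sub>M count_space UNIV \<rightarrow>\<^sub>M count_space UNIV"
    by (simp add: pair_measure_countable)
  moreover have "(\<lambda>q :: (real \<times> bit) \<times> bool. (snd (fst q), snd q)) \<in>
      (borel \<Otimes>\<^sub>M count_space UNIV) \<Otimes>\<^sub>M count_space UNIV \<rightarrow>\<^sub>M count_space UNIV \<Otimes>\<^sub>M count_space UNIV"
    by (intro measurable_Pair measurable_compose[OF measurable_fst measurable_snd] measurable_snd)
  ultimately have [measurable]: "(\<lambda>q. snd (fst q) + f (snd q)) \<in>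
      (borel \<Otimes>\<^sub>M count_space UNIV) \<Otimes>\<^sub>M count_space UNIV \<rightarrow>\<^sub>M (count_space UNIV)"
    by (auto dest: measurable_compose)
  have T [measurable]: "T \<in> (borel \<Otimes>\<^sub>M count_space UNIV) \<Otimes>\<^sub>M count_space UNIV \<rightarrow>\<^sub>M (borel \<Otimes>\<^sub>M count_space UNIV)"
    unfolding T_def by measurable
  define M where "M = distr (N \<Otimes>\<^sub>M B) (borel \<Otimes>\<^sub>M count_space UNIV) T"
  have M: "M \<in> prob_R_Z2"
    by (auto simp: prob_R_Z2_def borel_R_Z2_def M_def intro!: NB.prob_space_distr)
  have char_M: "char_R_Z2 M (s, l) = char_R_Z2 N (s, l) * (if l = 0 then 1 else of_real c)" for s l
  proof -
    have psi_T: "psi (s, l) (T (p, j)) = psi (s, l) p * minus_one_power (f j * l)" for p j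
      by (simp add: psi_def T_def minus_one_power_add distrib_right)
    have "integrable (N \<Otimes>\<^sub>M B) (\<lambda>q. psi (s, l) (T q))"
      by (rule NB.integrable_const_bound[of _ 1]) auto
    then have "(\<integral>p. (\<integral>j. psi (s, l) (T (p, j)) \<partial>B) \<partial>N) = (\<integral>q. psi (s, l) (T q) \<partial>(N \<Otimes>\<^sub>M B))"
      by (rule NB.integral_fst')
    moreover have "(LINT j|B. minus_one_power (f j * l)) = (if l = 0 then 1 else of_real c)"
    proof -
      have *: "(\<lambda>j. minus_one_power (f j * l)) = (\<lambda>j. if l = 0 then 1 else if j then - 1 else 1)"
        by (cases l) (auto simp: f_def)
      \<comment> \<open>Only inside this range does \<open>bernoulli_pmf\<close> keep its parameter;
        the mean sign is then 1 - 2 * ((1 - c) / 2) = c.\<close>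
      moreover have "0 \<le> (1 - c) / 2" "(1 - c) / 2 \<le> 1" using c by auto
      ultimately show ?thesis
        unfolding B_def *
        by (subst integral_measure_pmf[of UNIV]) (auto simp: UNIV_bool scaleR_conv_of_real field_simps)
    qed
    ultimately show ?thesis
      by (simp add: M_def char_R_Z2_psi integral_distr psi_T)
  qed
  have "N' = M"
  proof (rule char_R_Z2_uniqueness[OF N(2) M])
    show "char_R_Z2 N' y = char_R_Z2 M y" for y
      using eq0 eq1 by (cases y; cases "snd y") (auto simp: char_M)
  qed
  define g :: "bool \<Rightarrow> X" where "g = (\<lambda>j. (0, circle_of_complex (if j then - 1 else 1)))"
  have tau_T: "tau a b (T q) = tau a b (fst q) + g (snd q)" for q
    by (cases "snd q") (auto simp: tau_def T_def g_def f_def case_prod_unfold minus_one_power_add norm_mult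
        plus_circle.rep_eq complex_of_circle_inject[symmetric])
  have [measurable]: "g \<in> borel_measurable B" by (simp add: B_def)
  have "distr N' borel (tau a b) = distr (N \<Otimes>\<^sub>M B) borel (\<lambda>q. tau a b (T q))"
    unfolding \<open>N' = M\<close> M_def by (subst distr_distr) (auto simp: comp_def)
  also have "\<dots> = distr (distr (N \<Otimes>\<^sub>M B) (borel \<Otimes>\<^sub>M borel) (\<lambda>(p, j). (tau a b p, g j))) borel (\<lambda>(x, y). x + y)"
    by (subst distr_distr) (auto simp: comp_def case_prod_unfold tau_T)
  also have "distr (N \<Otimes>\<^sub>M B) (borel \<Otimes>\<^sub>M borel) (\<lambda>(p, j). (tau a b p, g j)) =
      distr N borel (tau a b) \<Otimes>\<^sub>M distr B borel g"
    by (intro pair_measure_distr[symmetric]) (auto intro!: prob_space_imp_sigma_finite B.prob_space_distr)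
  finally show ?thesis
    by (simp add: convol_def two_point_G_def B_def g_def)
qed

text \<open>Characters of modulus 1 are almost surely constant. Agreement of two points at small
  enough frequencies \<open>(s, 0)\<close> identifies their real coordinates, and then
  \<open>(r, 2)\<close> identifies the squares of their circle coordinates, so they differ by an
  element of G.\<close>

lemma prob_on_subgroup_G_if_norm_char_1:
  fixes \<mu> :: "X measure"
  assumes "prob_space \<mu>" and sets [measurable_cong]: "sets \<mu> = sets borel"
    and real: "\<And>s. norm (char_X \<mu> (s, 0)) = 1" and circle: "norm (char_X \<mu> (r, 2)) = 1"
  shows "\<exists>x. \<mu> \<^bold>* degenerate x \<in> prob_on subgroup_G"
proof -
  interpret prob_space \<mu> by fact
  have AE_chi: "AE x in \<mu>. chi y x = char_X \<mu> y" if "norm (char_X \<mu> y) = 1" for y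
    using AE_eq_expectation_if_norm_1[of "chi y"] that by (simp add: char_X_chi)
  \<comment> \<open>Countably many frequencies keep the exceptional set null. For a given pair of
    points, n is later taken so large that their phases at frequency 1 / (n + 1) differ by less than
    1, which excludes a nonzero multiple of 2 * pi.\<close>
  define A where "A = {x. (\<forall>n. chi (1 / real (Suc n), 0) x = char_X \<mu> (1 / real (Suc n), 0)) \<and>
      chi (r, 2) x = char_X \<mu> (r, 2)}"
  have A: "AE x in \<mu>. x \<in> A"
    unfolding A_def mem_Collect_eq by (intro AE_conjI AE_all_countable[THEN iffD2] allI AE_chi real circle)
  have "\<exists>x. x \<in> A"
  proof (rule ccontr)
    assume *: "\<not> ?thesis"
    have "AE x in \<mu>. False" using A by eventually_elim (use * in blast)
    then show False by simp
  qed
  then obtain x0 where x0: "x0 \<in> A" ..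
  have G: "x + - x0 \<in> subgroup_G" if x: "x \<in> A" for x
  proof -
    have chi_eq: "chi (1 / real (Suc n), 0) x = chi (1 / real (Suc n), 0) x0" "chi (r, 2) x = chi (r, 2) x0" for n
      using x x0 by (auto simp: A_def)
    obtain n where n: "\<bar>fst x - fst x0\<bar> < real n"
      using reals_Archimedean2 by blast
    define u where "u = (fst x - fst x0) / real (Suc n)"
    have "cis u = 1"
      using chi_eq(1)[of n] by (simp add: chi_def u_def diff_divide_distrib flip: cis_divide)
    then have "cos u = 1" by (simp add: complex_eq_iff)
    then obtain m :: int where m: "u = of_int m * 2 * pi" using cos_one_2pi_int by blast
    have u: "\<bar>u\<bar> < 1" using n by (simp add: u_def)
    have "m = 0"
    proof (rule ccontr)
      assume "m \<noteq> 0"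
      then have "1 * (2 * pi) \<le> \<bar>real_of_int m\<bar> * (2 * pi)" by (intro mult_right_mono) auto
      also have "\<dots> = \<bar>u\<bar>" unfolding m by (simp add: abs_mult)
      finally show False using u pi_gt3 by simp
    qed
    then have fst: "fst x = fst x0" using m by (simp add: u_def)
    have "(complex_of_circle (snd x))\<^sup>2 = (complex_of_circle (snd x0))\<^sup>2"
      using chi_eq(2) by (simp add: chi_def fst)
    then have "complex_of_circle (snd x) = complex_of_circle (snd x0) \<or>
        complex_of_circle (snd x) = - complex_of_circle (snd x0)"
      by (simp only: power2_eq_iff)
    then have "complex_of_circle (snd x + - snd x0) = 1 \<or> complex_of_circle (snd x + - snd x0) = - 1"
      by (auto simp: minus_circle.rep_eq)
    then show ?thesis
      unfolding subgroup_G_def by (auto simp: prod_eq_iff fst complex_of_circle_inject[symmetric])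
  qed
  have G_sets: "subgroup_G \<in> sets borel"
    by (intro borel_closed finite_imp_closed) (simp add: subgroup_G_def)
  have [measurable]: "(\<lambda>x :: X. x + - x0) \<in> borel_measurable borel"
    by (intro borel_measurable_continuous_onI continuous_intros)
  have "AE x in \<mu>. x + - x0 \<in> subgroup_G"
    using A by eventually_elim (rule G)
  then have "AE y in distr \<mu> borel (\<lambda>x. x + - x0). y \<in> subgroup_G"
    using G_sets by (subst AE_distr_iff) (auto simp del: add_uminus_conv_diff)
  moreover have prob: "prob_space (distr \<mu> borel (\<lambda>x. x + - x0))"
    by (rule prob_space_distr) measurable
  ultimately have "measure (distr \<mu> borel (\<lambda>x. x + - x0)) subgroup_G = 1"
    using G_sets by (subst prob_space.prob_eq_1) auto
  then have "\<mu> \<^bold>* degenerate (- x0) \<in> prob_on subgroup_G"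
    using prob by (subst convol_degenerate) (auto simp: prob_on_def sets prob_space_axioms)
  then show ?thesis by blast
qed

section \<open>Gaussian distributions\<close>

lemma char_normal_density:
  assumes r: "r > 0"
  shows "char (density lborel (\<lambda>x. ennreal (normal_density m r x))) s =
    iexp (s * m) * of_real (exp (- (s * r)\<^sup>2 / 2))"
proof -
  interpret std: prob_space std_normal_distribution
    by (rule prob_space_normal_density) simp
  have "distributed std_normal_distribution lborel (\<lambda>x. x) (normal_density 0 1)"
    by (simp add: distributed_def distr_id2)
  from std.normal_density_affine[OF this, of r m] r
  have "distributed std_normal_distribution lborel (\<lambda>x. m + r * x) (normal_density m r)"
    by simp
  then have "density lborel (\<lambda>x. ennreal (normal_density m r x)) =
      distr std_normal_distribution lborel (\<lambda>x. m + r * x)"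
    by (simp add: distributed_def)
  then have "char (density lborel (\<lambda>x. ennreal (normal_density m r x))) s =
      (LINT x|std_normal_distribution. iexp (s * (m + r * x)))"
    by (simp only: char_def) (subst integral_distr; simp)
  also have "(\<lambda>x. iexp (s * (m + r * x))) = (\<lambda>x. iexp (s * m) * iexp ((s * r) * x))"
    by (simp add: fun_eq_iff algebra_simps flip: exp_add)
  also have "(LINT x|std_normal_distribution. iexp (s * m) * iexp ((s * r) * x)) =
      iexp (s * m) * char std_normal_distribution (s * r)"
    by (simp add: char_def)
  finally show ?thesis by (simp add: char_std_normal_distribution)
qed

lemma gaussian_if_char_R_Z2:
  assumes N: "N \<in> prob_R_Z2" and \<sigma>: "\<sigma> \<ge> 0"
    and char: "\<And>s. char_R_Z2 N (s, 0) = exp (of_real (- \<sigma> * s\<^sup>2) + \<i> * of_real (\<beta> * s))"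
  shows "distr N borel fst \<in> gaussian"
proof -
  interpret prob_space N using N by (rule prob_space_prob_R_Z2)
  note [measurable_cong] = sets_prob_R_Z2[OF N]
  have char_fst: "char (distr N borel fst) = (\<lambda>s. exp (of_real (- \<sigma> * s\<^sup>2) + \<i> * of_real (\<beta> * s)))"
  proof
    fix s
    have "char (distr N borel fst) s = char_R_Z2 N (s, 0)"
      by (simp add: char_def integral_distr char_R_Z2_psi psi_def cis_conv_exp mult.commute)
    then show "char (distr N borel fst) s = exp (of_real (- \<sigma> * s\<^sup>2) + \<i> * of_real (\<beta> * s))"
      by (simp only: char)
  qed
  have rd: "real_distribution (distr N borel fst)"
    by (rule real_distribution_distr) simp
  show ?thesis
  proof (cases "\<sigma> = 0")
    case True
    have "distr N borel fst = return borel \<beta>"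
    proof (rule Levy_uniqueness[OF rd])
      show "real_distribution (return borel \<beta>)"
        by (simp add: real_distribution_def real_distribution_axioms_def prob_space_return)
      show "char (distr N borel fst) = char (return borel \<beta>)"
        unfolding char_fst by (auto simp: char_def True integral_return mult.commute)
    qed
    then show ?thesis by (auto simp: gaussian_def)
  next
    case False
    with \<sigma> have r: "sqrt (2 * \<sigma>) > 0" by simp
    \<comment> \<open>The normal characteristic function carries half the variance in its exponent,
      so the variance is 2 * \<sigma>.\<close>
    have "distr N borel fst = density lborel (\<lambda>x. ennreal (normal_density \<beta> (sqrt (2 * \<sigma>)) x))"
    proof (rule Levy_uniqueness[OF rd])
      show "real_distribution (density lborel (\<lambda>x. ennreal (normal_density \<beta> (sqrt (2 * \<sigma>)) x)))"
        using prob_space_normal_density[OF r, of \<beta>]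
        by (simp add: real_distribution_def real_distribution_axioms_def)
      show "char (distr N borel fst) = char (density lborel (\<lambda>x. ennreal (normal_density \<beta> (sqrt (2 * \<sigma>)) x)))"
        unfolding char_fst fun_eq_iff char_normal_density[OF r] using \<sigma>
        by (auto simp: power_mult_distrib exp_of_real[symmetric] exp_add[symmetric] algebra_simps
            simp del: exp_of_real)
    qed
    then show ?thesis using r unfolding gaussian_def by blast
  qed
qed

lemma normal_density_zero_mean_times_exp:
  assumes "v > 0" and w: "w > 0" "1 / w\<^sup>2 = 1 / v\<^sup>2 + 2 * \<sigma>"
  shows "normal_density 0 v s * exp (- \<sigma> * s\<^sup>2) = w / v * normal_density 0 w s"
proof -
  have "- (s\<^sup>2 / (2 * v\<^sup>2)) + - \<sigma> * s\<^sup>2 = - (s\<^sup>2 / 2 * (1 / v\<^sup>2 + 2 * \<sigma>))"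
    by (simp add: field_simps)
  also have "\<dots> = - (s\<^sup>2 / (2 * w\<^sup>2))"
    unfolding w(2)[symmetric] by simp
  finally have "exp (- (s\<^sup>2 / (2 * v\<^sup>2))) * exp (- \<sigma> * s\<^sup>2) = exp (- (s\<^sup>2 / (2 * w\<^sup>2)))"
    by (metis exp_add)
  then show ?thesis
    using assms by (simp add: normal_density_def real_sqrt_mult mult.assoc)
qed

text \<open>The real Gaussian factor changes the normal weight of deviation v into w / v times the
  one of deviation w; the remaining oscillation yields its characteristic function at \<beta> -
  x.\<close>

lemma integral_normal_density_gaussian_char:
  assumes v: "v > 0" and w: "w > 0" "1 / w\<^sup>2 = 1 / v\<^sup>2 + 2 * \<sigma>"
  shows "(LINT s|density lborel (\<lambda>s. ennreal (normal_density 0 v s)).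
      iexp (- x * s) * exp (of_real (- \<sigma> * s\<^sup>2) + \<i> * of_real (\<beta> * s))) =
    of_real (w / v * exp (- (w * (x - \<beta>))\<^sup>2 / 2))"
proof -
  have [measurable]: "(\<lambda>s. iexp (- x * s) * exp (of_real (- \<sigma> * s\<^sup>2) + \<i> * of_real (\<beta> * s))) \<in> borel_measurable borel"
    by (intro borel_measurable_continuous_onI continuous_intros)
  have [measurable]: "(\<lambda>s. iexp ((\<beta> - x) * s)) \<in> borel_measurable borel"
    by (intro borel_measurable_continuous_onI continuous_intros)
  have "(LINT s|density lborel (\<lambda>s. ennreal (normal_density 0 v s)).
      iexp (- x * s) * exp (of_real (- \<sigma> * s\<^sup>2) + \<i> * of_real (\<beta> * s))) =
    (LINT s|lborel. normal_density 0 v s *\<^sub>R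
      (iexp (- x * s) * exp (of_real (- \<sigma> * s\<^sup>2) + \<i> * of_real (\<beta> * s))))"
    by (subst integral_density) auto
  also have "\<dots> = (LINT s|lborel. (w / v) *\<^sub>R (normal_density 0 w s *\<^sub>R iexp ((\<beta> - x) * s)))"
  proof (rule Bochner_Integration.integral_cong[OF refl])
    fix s
    have "iexp (- x * s) * exp (of_real (- \<sigma> * s\<^sup>2) + \<i> * of_real (\<beta> * s)) =
        of_real (exp (- \<sigma> * s\<^sup>2)) * iexp ((\<beta> - x) * s)"
      by (simp add: exp_of_real[symmetric] exp_add[symmetric] algebra_simps del: exp_of_real)
    then show "normal_density 0 v s *\<^sub>R (iexp (- x * s) * exp (of_real (- \<sigma> * s\<^sup>2) + \<i> * of_real (\<beta> * s))) =
      (w / v) *\<^sub>R (normal_density 0 w s *\<^sub>R iexp ((\<beta> - x) * s))"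
      using arg_cong[OF normal_density_zero_mean_times_exp[OF v w, of s], of complex_of_real]
      by (simp add: scaleR_conv_of_real mult.assoc[symmetric])
  qed
  also have "\<dots> = (w / v) *\<^sub>R (LINT s|lborel. normal_density 0 w s *\<^sub>R iexp ((\<beta> - x) * s))"
    by (rule integral_scaleR_right)
  also have "(LINT s|lborel. normal_density 0 w s *\<^sub>R iexp ((\<beta> - x) * s)) =
      char (density lborel (\<lambda>s. ennreal (normal_density 0 w s))) (\<beta> - x)"
    unfolding char_def by (subst integral_density) auto
  also have "\<dots> = of_real (exp (- (w * (x - \<beta>))\<^sup>2 / 2))"
    by (subst char_normal_density[OF w(1)]) (simp add: power_mult_distrib power2_commute mult.commute)
  finally show ?thesis by (simp add: scaleR_conv_of_real)
qed

text \<open>Integrating the nonnegative functions \<open>(1 \<plusminus> (-1)\<^sup>k) exp (- (v (t - x))\<^sup>2 / 2)\<close>, whose Gaussian factor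
  is itself a characteristic function, avoids any appeal to densities of the two components.\<close>

lemma gaussian_pair_positivity:
  assumes N: "N \<in> prob_R_Z2" and \<sigma>: "\<sigma> \<ge> 0" "\<sigma>' \<ge> 0" and \<epsilon>: "\<epsilon> > 0"
    and char0: "\<And>s. char_R_Z2 N (s, 0) = exp (of_real (- \<sigma> * s\<^sup>2) + \<i> * of_real (\<beta> * s))"
    and char1: "\<And>s. char_R_Z2 N (s, 1) = of_real \<kappa> * exp (of_real (- \<sigma>' * s\<^sup>2) + \<i> * of_real (\<beta>' * s))"
  shows "\<bar>\<kappa>\<bar> * (exp (- (x - \<beta>')\<^sup>2 / (4 * (\<epsilon> + \<sigma>'))) / sqrt (\<epsilon> + \<sigma>')) \<le>
    exp (- (x - \<beta>)\<^sup>2 / (4 * (\<epsilon> + \<sigma>))) / sqrt (\<epsilon> + \<sigma>)"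
proof -
  interpret prob_space N using N by (rule prob_space_prob_R_Z2)
  note [measurable_cong] = sets_prob_R_Z2[OF N]
  \<comment> \<open>With 1 / v^2 = 2 * \<epsilon> the effect is that of normal noise of variance 2 *
    \<epsilon> in the real coordinate: \<sigma> and \<sigma>' become \<epsilon> + \<sigma> and
    \<epsilon> + \<sigma>', which are positive even for degenerate components.\<close>
  define v where "v = 1 / sqrt (2 * \<epsilon>)"
  define W where "W \<sigma> = 1 / sqrt (2 * (\<epsilon> + \<sigma>))" for \<sigma>
  have v: "v > 0" "1 / v\<^sup>2 = 2 * \<epsilon>" using \<epsilon> by (simp_all add: v_def power_divide)
  have W: "W \<sigma> > 0" "1 / (W \<sigma>)\<^sup>2 = 1 / v\<^sup>2 + 2 * \<sigma>" if "\<sigma> \<ge> 0" for \<sigma>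
    using that \<epsilon> by (simp_all add: W_def v(2) power_divide)
  define \<nu> where "\<nu> = density lborel (\<lambda>s. ennreal (normal_density 0 v s))"
  interpret \<nu>: prob_space \<nu> unfolding \<nu>_def by (rule prob_space_normal_density) (rule v(1))
  have [measurable_cong]: "sets \<nu> = sets borel" by (simp add: \<nu>_def)
  interpret N\<nu>: pair_prob_space N \<nu> ..
  define I where "I \<sigma> \<beta> = W \<sigma> / v * exp (- (W \<sigma> * (x - \<beta>))\<^sup>2 / 2)" for \<sigma> \<beta>
  define \<phi> where "\<phi> t = exp (- ((t - x) * v)\<^sup>2 / 2)" for t
  \<comment> \<open>\<open>\<phi> t\<close> is the average of \<open>iexp ((t - x) * s)\<close> over
    the normal weight; exchanging the integrals leaves only the known characteristic function of
    N.\<close>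
  have swap: "(\<integral>p. psi (0, l) p * of_real (\<phi> (fst p)) \<partial>N) = (\<integral>s. iexp (- x * s) * char_R_Z2 N (s, l) \<partial>\<nu>)" for l
  proof -
    define F where "F p s = iexp (- x * s) * psi (s, l) p" for p s
    have F_eq: "F p s = psi (0, l) p * iexp ((fst p - x) * s)" for p s
      by (simp add: F_def psi_def cis_conv_exp exp_add[symmetric] algebra_simps)
    have [measurable]: "(\<lambda>q. iexp ((fst (fst q) - x) * snd q)) \<in> borel_measurable (N \<Otimes>\<^sub>M \<nu>)"
    proof -
      have [measurable]: "iexp \<in> borel_measurable borel"
        by (intro borel_measurable_continuous_onI continuous_intros)
      have "(\<lambda>q. (fst (fst q) - x) * snd q) \<in> borel_measurable (N \<Otimes>\<^sub>M \<nu>)" by measurable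
      from measurable_compose[OF this \<open>iexp \<in> borel_measurable borel\<close>] show ?thesis .
    qed
    have "integrable (N \<Otimes>\<^sub>M \<nu>) (\<lambda>q. psi (0, l) (fst q) * iexp ((fst (fst q) - x) * snd q))"
      by (rule N\<nu>.integrable_const_bound[of _ 1]) (auto simp: norm_mult)
    then have "integrable (N \<Otimes>\<^sub>M \<nu>) (\<lambda>(p, s). F p s)"
      by (simp add: F_eq case_prod_unfold)
    then have "(\<integral>s. (\<integral>p. F p s \<partial>N) \<partial>\<nu>) = (\<integral>p. (\<integral>s. F p s \<partial>\<nu>) \<partial>N)"
      by (rule N\<nu>.Fubini_integral)
    moreover have "(\<integral>p. F p s \<partial>N) = iexp (- x * s) * char_R_Z2 N (s, l)" for s
      by (simp add: F_def char_R_Z2_psi)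
    moreover have "(\<integral>s. F p s \<partial>\<nu>) = psi (0, l) p * of_real (\<phi> (fst p))" for p
    proof -
      have "(\<integral>s. F p s \<partial>\<nu>) = psi (0, l) p * char \<nu> (fst p - x)"
        by (simp add: F_eq char_def)
      then show ?thesis
        unfolding \<nu>_def char_normal_density[OF v(1)] by (simp add: \<phi>_def)
    qed
    ultimately show ?thesis by simp
  qed
  have int0: "(\<integral>p. psi (0, 0) p * of_real (\<phi> (fst p)) \<partial>N) = of_real (I \<sigma> \<beta>)"
    unfolding swap char0 \<nu>_def I_def
    by (rule integral_normal_density_gaussian_char[OF v(1) W[OF \<sigma>(1)]])
  have int1: "(\<integral>p. psi (0, 1) p * of_real (\<phi> (fst p)) \<partial>N) = of_real (\<kappa> * I \<sigma>' \<beta>')"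
  proof -
    have "(\<integral>p. psi (0, 1) p * of_real (\<phi> (fst p)) \<partial>N) =
      (\<integral>s. of_real \<kappa> * (iexp (- x * s) * exp (of_real (- \<sigma>' * s\<^sup>2) + \<i> * of_real (\<beta>' * s))) \<partial>\<nu>)"
      unfolding swap char1 by (simp add: mult_ac)
    also have "\<dots> = of_real \<kappa> * of_real (I \<sigma>' \<beta>')"
      unfolding integral_mult_right_zero \<nu>_def I_def
      by (subst integral_normal_density_gaussian_char[OF v(1) W[OF \<sigma>(2)]]) simp
    finally show ?thesis by simp
  qed
  have int\<phi>: "integrable N (\<lambda>p. psi (0, l) p * of_real (\<phi> (fst p)))" for l
    by (rule integrable_const_bound[of _ 1]) (auto simp: \<phi>_def norm_mult)
  \<comment> \<open>For either sign the weight 1 + \<eta> * (-1)^k takes only the values 0 and 2, so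
    it selects one of the two lines; the two signs together bound the absolute value.\<close>
  have "0 \<le> I \<sigma> \<beta> + \<eta> * (\<kappa> * I \<sigma>' \<beta>')" if \<eta>: "\<eta> = 1 \<or> \<eta> = -1" for \<eta> :: real
  proof -
    have "of_real (I \<sigma> \<beta> + \<eta> * (\<kappa> * I \<sigma>' \<beta>')) =
      (\<integral>p. psi (0, 0) p * of_real (\<phi> (fst p)) + of_real \<eta> * (psi (0, 1) p * of_real (\<phi> (fst p))) \<partial>N)"
      using int\<phi> by (simp add: int0 int1)
    also have "\<dots> = (\<integral>p. complex_of_real ((1 + \<eta> * (if snd p = 0 then 1 else -1)) * \<phi> (fst p)) \<partial>N)"
      by (intro Bochner_Integration.integral_cong[OF refl])
        (auto simp: psi_def minus_one_power_def algebra_simps)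
    also have "\<dots> = of_real (\<integral>p. (1 + \<eta> * (if snd p = 0 then 1 else -1)) * \<phi> (fst p) \<partial>N)"
      by (rule integral_complex_of_real)
    finally have "I \<sigma> \<beta> + \<eta> * (\<kappa> * I \<sigma>' \<beta>') = (\<integral>p. (1 + \<eta> * (if snd p = 0 then 1 else -1)) * \<phi> (fst p) \<partial>N)"
      by (simp only: of_real_eq_iff)
    also have "\<dots> \<ge> 0"
      using \<eta> by (intro Bochner_Integration.integral_nonneg) (auto simp: \<phi>_def)
    finally show ?thesis .
  qed
  from this[of 1] this[of "-1"] have "\<bar>\<kappa> * I \<sigma>' \<beta>'\<bar> \<le> I \<sigma> \<beta>" by auto
  moreover have I: "I \<sigma> \<beta> = exp (- (x - \<beta>)\<^sup>2 / (4 * (\<epsilon> + \<sigma>))) / sqrt (\<epsilon> + \<sigma>) * sqrt \<epsilon>" if "\<sigma> \<ge> 0" for \<sigma> \<beta>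
    using that \<epsilon> by (simp add: I_def W_def v_def real_sqrt_mult power_mult_distrib power_divide field_simps)
      (simp add: algebra_simps flip: real_sqrt_mult)
  ultimately have "\<bar>\<kappa>\<bar> * (exp (- (x - \<beta>')\<^sup>2 / (4 * (\<epsilon> + \<sigma>'))) / sqrt (\<epsilon> + \<sigma>')) * sqrt \<epsilon> \<le>
    exp (- (x - \<beta>)\<^sup>2 / (4 * (\<epsilon> + \<sigma>))) / sqrt (\<epsilon> + \<sigma>) * sqrt \<epsilon>"
    using \<sigma> \<epsilon> by (simp add: abs_mult)
  then show ?thesis
    by (rule mult_right_le_imp_le) (use \<epsilon> in simp)
qed

section \<open>Parameters of the class \<open>\<Theta>\<close>\<close>

lemma quadratic_bounded_below:
  fixes A B C L :: real
  assumes L: "\<And>x. L \<le> A * x\<^sup>2 + B * x + C"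
  shows "A \<ge> 0" and "A = 0 \<Longrightarrow> B = 0"
proof -
  show "A \<ge> 0"
  proof (rule ccontr)
    assume A: "\<not> A \<ge> 0"
    \<comment> \<open>This makes \<open>A * x\<^sup>2\<close> equal to
      \<open>- (\<bar>L - C\<bar> + 1)\<close>; adding the bounds at x and -x removes the linear
      term.\<close>
    define x where "x = sqrt ((\<bar>L - C\<bar> + 1) / (- A))"
    have "x\<^sup>2 = (\<bar>L - C\<bar> + 1) / (- A)"
      unfolding x_def using A by (intro real_sqrt_pow2 divide_nonneg_pos) auto
    then have "A * x\<^sup>2 = - (\<bar>L - C\<bar> + 1)" using A by (simp add: field_simps)
    then show False using L[of x] L[of "- x"] by simp
  qed
  show "B = 0" if "A = 0"
  proof (rule ccontr)
    assume "B \<noteq> 0"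
    then show False using L[of "(L - C - 1) / B"] that by simp
  qed
qed

text \<open>At \<epsilon> = 1 the logarithm of the inequality bounds a quadratic in x from below.
  This orders \<sigma>' and \<sigma>, and equates the means when these coincide. If \<sigma>' <
  \<sigma>, evaluation at the minimum of the quadratic gives the sharp bound on \<kappa> for each
  \<epsilon>.\<close>

lemma gaussian_domination_imp_Theta_parameters:
  fixes \<kappa> \<sigma> \<sigma>' \<beta> \<beta>' :: real
  assumes \<kappa>: "\<kappa> \<noteq> 0" and \<sigma>: "\<sigma> \<ge> 0" "\<sigma>' \<ge> 0"
    and le: "\<And>\<epsilon> x. \<epsilon> > 0 \<Longrightarrow> \<bar>\<kappa>\<bar> * (exp (- (x - \<beta>')\<^sup>2 / (4 * (\<epsilon> + \<sigma>'))) / sqrt (\<epsilon> + \<sigma>')) \<le>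
      exp (- (x - \<beta>)\<^sup>2 / (4 * (\<epsilon> + \<sigma>))) / sqrt (\<epsilon> + \<sigma>)"
  shows "(0 < \<sigma>' \<and> \<sigma>' < \<sigma> \<and> 0 < \<bar>\<kappa>\<bar> \<and>
         \<bar>\<kappa>\<bar> \<le> sqrt (\<sigma>' / \<sigma>) * exp (- ((\<beta> - \<beta>')\<^sup>2 / (4 * (\<sigma> - \<sigma>')))))
        \<or> (\<sigma> = \<sigma>' \<and> \<beta> = \<beta>' \<and> \<bar>\<kappa>\<bar> \<le> 1)"
proof -
  define p q where "p = 1 + \<sigma>" and "q = 1 + \<sigma>'"
  have pq: "p > 0" "q > 0" using \<sigma> by (simp_all add: p_def q_def)
  have quad: "ln (\<bar>\<kappa>\<bar> / sqrt q) - ln (1 / sqrt p) \<le>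
      (1 / (4 * q) - 1 / (4 * p)) * x\<^sup>2 + (\<beta> / (2 * p) - \<beta>' / (2 * q)) * x + (\<beta>'\<^sup>2 / (4 * q) - \<beta>\<^sup>2 / (4 * p))" for x
  proof -
    have "\<bar>\<kappa>\<bar> / sqrt q * exp (- (x - \<beta>')\<^sup>2 / (4 * q)) \<le> 1 / sqrt p * exp (- (x - \<beta>)\<^sup>2 / (4 * p))"
      using le[of 1 x] by (simp add: p_def q_def)
    moreover have ln_exp: "ln (u * exp y) = ln u + y" if "u > 0" for u y :: real
      using that by (simp add: ln_mult)
    ultimately have "ln (\<bar>\<kappa>\<bar> / sqrt q * exp (- (x - \<beta>')\<^sup>2 / (4 * q))) \<le> ln (1 / sqrt p * exp (- (x - \<beta>)\<^sup>2 / (4 * p)))"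
      using \<kappa> pq by (intro ln_mono) auto
    then have "ln (\<bar>\<kappa>\<bar> / sqrt q) - ln (1 / sqrt p) \<le> (x - \<beta>')\<^sup>2 / (4 * q) - (x - \<beta>)\<^sup>2 / (4 * p)"
      using \<kappa> pq by (subst (asm) (1 2) ln_exp) (simp_all del: ln_div)
    also have "\<dots> = (1 / (4 * q) - 1 / (4 * p)) * x\<^sup>2 + (\<beta> / (2 * p) - \<beta>' / (2 * q)) * x + (\<beta>'\<^sup>2 / (4 * q) - \<beta>\<^sup>2 / (4 * p))"
      using pq by (simp add: field_simps power2_eq_square)
    finally show ?thesis .
  qed
  have "1 / (4 * q) - 1 / (4 * p) \<ge> 0"
    by (rule quadratic_bounded_below(1)[OF quad])
  then have "\<sigma>' \<le> \<sigma>" using pq by (simp add: p_def q_def field_simps)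
  then consider "\<sigma> = \<sigma>'" | "\<sigma>' < \<sigma>" by linarith
  then show ?thesis
  proof cases
    case 1
    then have [simp]: "q = p" by (simp add: p_def q_def)
    have "\<beta> / (2 * p) - \<beta>' / (2 * q) = 0"
      by (rule quadratic_bounded_below(2)[OF quad]) simp
    then have "\<beta> = \<beta>'" using pq by simp
    moreover have "\<bar>\<kappa>\<bar> \<le> 1"
      using le[of 1 \<beta>] pq 1 \<open>\<beta> = \<beta>'\<close> by (simp add: p_def q_def divide_le_cancel)
    ultimately show ?thesis using 1 by simp
  next
    case 2
    define E where "E = exp (- ((\<beta> - \<beta>')\<^sup>2 / (4 * (\<sigma> - \<sigma>'))))"
    have bound: "\<bar>\<kappa>\<bar> \<le> sqrt ((\<epsilon> + \<sigma>') / (\<epsilon> + \<sigma>)) * E" if \<epsilon>: "\<epsilon> > 0" for \<epsilon>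
    proof -
      define P Q d where "P = \<epsilon> + \<sigma>" and "Q = \<epsilon> + \<sigma>'" and "d = (\<beta>' - \<beta>) / (\<sigma> - \<sigma>')"
      define x where "x = \<beta> + P * d" \<comment> \<open>the minimum of \<open>(x - \<beta>')\<^sup>2 / (4 * Q) - (x - \<beta>)\<^sup>2 / (4 * P)\<close>\<close>
      have PQ: "P > 0" "Q > 0" using \<epsilon> \<sigma> by (simp_all add: P_def Q_def)
      have d: "d * (\<sigma> - \<sigma>') = \<beta>' - \<beta>" using 2 by (simp add: d_def)
      have x: "x - \<beta> = P * d" "x - \<beta>' = Q * d"
        using d unfolding x_def P_def Q_def by (simp, algebra)
      have "\<bar>\<kappa>\<bar> * (exp (- (Q * d\<^sup>2 / 4)) / sqrt Q) \<le> exp (- (P * d\<^sup>2 / 4)) / sqrt P"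
      proof -
        have sq: "- (r * d)\<^sup>2 / (4 * r) = - (r * d\<^sup>2 / 4)" if "r > 0" for r
          using that by (simp add: power2_eq_square field_simps)
        show ?thesis
          using le[OF \<epsilon>, of x] unfolding P_def[symmetric] Q_def[symmetric] x sq[OF PQ(1)] sq[OF PQ(2)] .
      qed
      then have "\<bar>\<kappa>\<bar> * (exp (- (Q * d\<^sup>2 / 4)) / sqrt Q) * (sqrt Q * exp (Q * d\<^sup>2 / 4)) \<le>
          exp (- (P * d\<^sup>2 / 4)) / sqrt P * (sqrt Q * exp (Q * d\<^sup>2 / 4))"
        using PQ by (intro mult_right_mono) auto
      also have "\<bar>\<kappa>\<bar> * (exp (- (Q * d\<^sup>2 / 4)) / sqrt Q) * (sqrt Q * exp (Q * d\<^sup>2 / 4)) = \<bar>\<kappa>\<bar>"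
        using PQ by (simp add: exp_minus field_simps)
      also have "exp (- (P * d\<^sup>2 / 4)) / sqrt P * (sqrt Q * exp (Q * d\<^sup>2 / 4)) =
          sqrt (Q / P) * exp (Q * d\<^sup>2 / 4 - P * d\<^sup>2 / 4)"
      proof -
        have "inverse u / s * (t * w) = t / s * (w / u)" for s t u w :: real
          by (simp add: divide_inverse)
        then show ?thesis unfolding exp_diff exp_minus real_sqrt_divide .
      qed
      \<comment> \<open>Since P - Q = \<sigma> - \<sigma>', the exponent does not depend on
        \<epsilon>; only the square root has to pass to the limit.\<close>
      also have "Q * d\<^sup>2 / 4 - P * d\<^sup>2 / 4 = - ((\<beta> - \<beta>')\<^sup>2 / (4 * (\<sigma> - \<sigma>')))"
      proof -
        have "Q * d\<^sup>2 / 4 - P * d\<^sup>2 / 4 = - (d * (d * (\<sigma> - \<sigma>')) / 4)"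
          by (simp add: P_def Q_def power2_eq_square field_simps)
        also have "\<dots> = - ((\<beta> - \<beta>')\<^sup>2 / (4 * (\<sigma> - \<sigma>')))"
          unfolding d by (simp add: d_def power2_eq_square algebra_simps)
        finally show ?thesis .
      qed
      finally show ?thesis by (simp add: E_def P_def Q_def)
    qed
    \<comment> \<open>The limit is taken in the final bound, where only \<sigma> > 0 stands in a
      denominator. It also excludes \<sigma>' = 0, which would force \<kappa> = 0.\<close>
    have "((\<lambda>\<epsilon>. sqrt ((\<epsilon> + \<sigma>') / (\<epsilon> + \<sigma>)) * E) \<longlongrightarrow> sqrt ((0 + \<sigma>') / (0 + \<sigma>)) * E) (at_right 0)"
      using 2 \<sigma> by (intro tendsto_intros) auto
    then have "\<bar>\<kappa>\<bar> \<le> sqrt ((0 + \<sigma>') / (0 + \<sigma>)) * E"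
    proof (rule tendsto_lowerbound)
      show "\<forall>\<^sub>F \<epsilon> in at_right 0. \<bar>\<kappa>\<bar> \<le> sqrt ((\<epsilon> + \<sigma>') / (\<epsilon> + \<sigma>)) * E"
        using bound by (simp add: eventually_at_right_less eventually_at_filter)
    qed simp
    moreover have "\<sigma>' > 0"
    proof (rule ccontr)
      assume "\<not> \<sigma>' > 0"
      then have "\<sigma>' = 0" using \<sigma> by simp
      then show False using calculation \<kappa> by simp
    qed
    ultimately show ?thesis using 2 \<kappa> by (simp add: E_def)
  qed
qed

lemma Theta_classI:
  assumes N: "N \<in> prob_R_Z2" and \<sigma>: "\<sigma> \<ge> 0" "\<sigma>' \<ge> 0" and \<kappa>: "\<kappa> \<noteq> 0"
    and char0: "\<And>s. char_R_Z2 N (s, 0) = exp (of_real (- \<sigma> * s\<^sup>2) + \<i> * of_real (\<beta> * s))"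
    and char1: "\<And>s. char_R_Z2 N (s, 1) = of_real \<kappa> * exp (of_real (- \<sigma>' * s\<^sup>2) + \<i> * of_real (\<beta>' * s))"
  shows "N \<in> Theta_class"
proof -
  have "(0 < \<sigma>' \<and> \<sigma>' < \<sigma> \<and> 0 < \<bar>\<kappa>\<bar> \<and>
         \<bar>\<kappa>\<bar> \<le> sqrt (\<sigma>' / \<sigma>) * exp (- ((\<beta> - \<beta>')\<^sup>2 / (4 * (\<sigma> - \<sigma>')))))
        \<or> (\<sigma> = \<sigma>' \<and> \<beta> = \<beta>' \<and> \<bar>\<kappa>\<bar> \<le> 1)"
    using gaussian_pair_positivity[OF N \<sigma> _ char0 char1]
    by (intro gaussian_domination_imp_Theta_parameters[OF \<kappa> \<sigma>])
  then show ?thesis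
    unfolding Theta_class_def using N \<sigma> char0 char1 by blast
qed

lemma heyde_R_Z2_form:
  assumes N: "N1 \<in> prob_R_Z2" "N2 \<in> prob_R_Z2" and a: "a \<noteq> 0" "a \<noteq> 1" "a \<noteq> -1"
    and eq: "\<And>s1 s2. char_R_Z2 N1 (s1 + s2, l) * char_R_Z2 N2 (s1 + a * s2, l) =
      char_R_Z2 N1 (s1 - s2, l) * char_R_Z2 N2 (s1 - a * s2, l)"
    and nz: "char_R_Z2 N1 (x, l) \<noteq> 0" "char_R_Z2 N2 (y, l) \<noteq> 0"
  obtains \<kappa>1 \<sigma>1 \<beta>1 \<kappa>2 \<sigma>2 \<beta>2 :: real where "\<sigma>1 \<ge> 0" "\<sigma>2 \<ge> 0" "\<sigma>1 + a * \<sigma>2 = 0" "\<kappa>1 \<noteq> 0" "\<kappa>2 \<noteq> 0"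
    "char_R_Z2 N1 (0, l) = of_real \<kappa>1" "char_R_Z2 N2 (0, l) = of_real \<kappa>2"
    "\<And>s. char_R_Z2 N1 (s, l) = of_real \<kappa>1 * exp (of_real (- \<sigma>1 * s\<^sup>2) + \<i> * of_real (\<beta>1 * s))"
    "\<And>s. char_R_Z2 N2 (s, l) = of_real \<kappa>2 * exp (of_real (- \<sigma>2 * s\<^sup>2) + \<i> * of_real (\<beta>2 * s))"
proof -
  note cont = continuous_on_char_R_Z2[OF N(1)] continuous_on_char_R_Z2[OF N(2)]
  note nonzero = heyde_nonvanishing[OF a cont eq nz]
  obtain c1 c2 d1 d2 where c: "\<And>x. char_R_Z2 N1 (x, l) = char_R_Z2 N1 (0, l) * exp (c1 * of_real x + c2 * of_real (x\<^sup>2))"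
    and d: "\<And>x. char_R_Z2 N2 (x, l) = char_R_Z2 N2 (0, l) * exp (d1 * of_real x + d2 * of_real (x\<^sup>2))"
    and cd: "c2 + of_real a * d2 = 0"
    by (rule heyde_exponential_form[OF a cont eq nonzero]) blast
  obtain \<kappa>1 \<sigma>1 \<beta>1 where 1: "\<sigma>1 \<ge> 0" "c2 = of_real (- \<sigma>1)" "\<kappa>1 \<noteq> 0" "char_R_Z2 N1 (0, l) = of_real \<kappa>1"
    "\<And>s. char_R_Z2 N1 (s, l) = of_real \<kappa>1 * exp (of_real (- \<sigma>1 * s\<^sup>2) + \<i> * of_real (\<beta>1 * s))"
    by (rule bounded_hermitian_exponential_form[of "\<lambda>x. char_R_Z2 N1 (x, l)", OF c nonzero(1)
          char_R_Z2_uminus norm_char_R_Z2_le[OF N(1)]]) blast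
  obtain \<kappa>2 \<sigma>2 \<beta>2 where 2: "\<sigma>2 \<ge> 0" "d2 = of_real (- \<sigma>2)" "\<kappa>2 \<noteq> 0" "char_R_Z2 N2 (0, l) = of_real \<kappa>2"
    "\<And>s. char_R_Z2 N2 (s, l) = of_real \<kappa>2 * exp (of_real (- \<sigma>2 * s\<^sup>2) + \<i> * of_real (\<beta>2 * s))"
    by (rule bounded_hermitian_exponential_form[of "\<lambda>x. char_R_Z2 N2 (x, l)", OF d nonzero(2)
          char_R_Z2_uminus norm_char_R_Z2_le[OF N(2)]]) blast
  have "of_real (- (\<sigma>1 + a * \<sigma>2)) = (0 :: complex)"
    using cd unfolding 1(2) 2(2) by (simp add: algebra_simps)
  then have "\<sigma>1 + a * \<sigma>2 = 0" by (simp only: of_real_eq_0_iff neg_equal_0_iff_equal)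
  with 1 2 show thesis using that by blast
qed

section \<open>Reduction to \<open>\<real> \<times> \<int>(2)\<close>\<close>

lemma norm_char_X_le: "prob_space \<mu> \<Longrightarrow> norm (char_X \<mu> y) \<le> 1"
proof -
  assume "prob_space \<mu>"
  then interpret prob_space \<mu> .
  have "norm (char_X \<mu> y) \<le> expectation (\<lambda>x. norm (chi y x))"
    unfolding char_X_chi by (rule integral_norm_bound)
  then show ?thesis by (simp add: prob_space)
qed

lemma char_X_zero: "prob_space \<mu> \<Longrightarrow> char_X \<mu> (0, 0) = 1"
  by (simp add: char_X_chi chi_def prob_space.prob_space)

lemma norms_eq_1_if_mult_eq_1:
  fixes z w :: complex
  assumes "norm (z * w) = 1" "norm z \<le> 1" "norm w \<le> 1"
  shows "norm z = 1" "norm w = 1"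
proof -
  have *: "norm z * norm w = 1" using assms(1) by (simp only: norm_mult)
  then have "1 \<le> norm z * 1"
    using mult_left_mono[OF assms(3), of "norm z"] by simp
  then show "norm z = 1" using assms(2) by simp
  then show "norm w = 1" using * by simp
qed

lemma chi_zero_fst: "chi (s, n) (0, e) = chi (0, n) (0, e)"
  by (simp add: chi_def)

lemma chi_nonzero [simp]: "chi y x \<noteq> 0"
  by (metis norm_chi norm_zero zero_neq_one)

text \<open>The character \<open>(-b n / (a - 1), n)\<close> is fixed by the adjoint of \<open>alpha a b\<close>.\<close>

lemma heyde_reduction:
  fixes \<mu>1 \<mu>2 :: "X measure"
  assumes \<mu>1: "prob_space \<mu>1" "sets \<mu>1 = sets borel" and \<mu>2: "prob_space \<mu>2" "sets \<mu>2 = sets borel"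
    and a: "a \<noteq> 1"
    and eq: "\<And>s1 s2 n1 n2. char_X \<mu>1 (s1 + s2, n1 + n2) * char_X \<mu>2 (s1 + (a * s2 + b * of_int n2), n1 + n2) =
      char_X \<mu>1 (s1 - s2, n1 - n2) * char_X \<mu>2 (s1 - (a * s2 + b * of_int n2), n1 - n2)"
  obtains e1 e2 N1 N2 where "N1 \<in> prob_R_Z2" "N2 \<in> prob_R_Z2"
    "\<mu>1 = distr N1 borel (tau a b) \<^bold>* degenerate (0, e1)" "\<mu>2 = distr N2 borel (tau a b) \<^bold>* degenerate (0, e2)"
    "\<And>s1 s2 l. char_R_Z2 N1 (s1 + s2, l) * char_R_Z2 N2 (s1 + a * s2, l) =
      char_R_Z2 N1 (s1 - s2, l) * char_R_Z2 N2 (s1 - a * s2, l)"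
proof -
  define c where "c = b / (a - 1)"
  have c: "- (c * a) + b = - c" using a by (simp add: c_def field_simps)
  have c2: "- 2 * b / (a - 1) = - c - c" by (simp add: c_def)
  \<comment> \<open>At u = v = (-c, 1), a fixed point of the adjoint, both arguments on the right
    are the trivial character.\<close>
  have prod: "norm (char_X \<mu>1 (- c - c, 2) * char_X \<mu>2 (- c - c, 2)) = 1"
    using eq[of "- c" "- c" 1 1] char_X_zero[OF \<mu>1(1)] char_X_zero[OF \<mu>2(1)] c
    by (simp add: mult.commute)
  note norms = norms_eq_1_if_mult_eq_1[OF prod norm_char_X_le[OF \<mu>1(1)] norm_char_X_le[OF \<mu>2(1)]]
  have AE: "AE x in \<mu>. chi (- 2 * b / (a - 1), 2) x = char_X \<mu> (- c - c, 2)"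
    if "prob_space \<mu>" "sets \<mu> = sets borel" "norm (char_X \<mu> (- c - c, 2)) = 1" for \<mu>
    using that prob_space.AE_eq_expectation_if_norm_1[of \<mu> "chi (- c - c, 2)"]
    unfolding c2 by (simp add: char_X_chi cong: measurable_cong_sets)
  obtain e1 N1 where 1: "N1 \<in> prob_R_Z2" "\<mu>1 = distr N1 borel (tau a b) \<^bold>* degenerate (0, e1)"
    by (rule tau_representation[OF \<mu>1 AE[OF \<mu>1 norms(1)]])
  obtain e2 N2 where 2: "N2 \<in> prob_R_Z2" "\<mu>2 = distr N2 borel (tau a b) \<^bold>* degenerate (0, e2)"
    by (rule tau_representation[OF \<mu>2 AE[OF \<mu>2 norms(2)]])
  have "char_R_Z2 N1 (s1 + s2, l) * char_R_Z2 N2 (s1 + a * s2, l) =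
      char_R_Z2 N1 (s1 - s2, l) * char_R_Z2 N2 (s1 - a * s2, l)" for s1 s2 l
  proof -
    define n :: int where "n = (if l = 0 then 0 else 1)"
    have l: "(if even n then 0 else 1) = l" by (cases l) (simp_all add: n_def)
    have char: "char_X (distr N borel (tau a b) \<^bold>* degenerate (0, e)) (s - c * of_int n, n) =
        chi (0, n) (0, e) * char_R_Z2 N (s, l)" if "N \<in> prob_R_Z2" for N e s
      unfolding char_X_tau[OF that] chi_zero_fst[of "s - c * of_int n" n e] l by (simp add: c_def)
    \<comment> \<open>Taking n2 = 0 removes b, and the offset \<open>- c * n\<close> undoes the
      frequency shift that \<open>tau\<close> produces, so the arguments become those of N1 and
      N2.\<close>
    have "char_X \<mu>1 ((s1 + s2) - c * of_int n, n) * char_X \<mu>2 ((s1 + a * s2) - c * of_int n, n) =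
        char_X \<mu>1 ((s1 - s2) - c * of_int n, n) * char_X \<mu>2 ((s1 - a * s2) - c * of_int n, n)"
      using eq[of "s1 - c * of_int n" s2 n 0] by (simp add: algebra_simps)
    then show ?thesis
      unfolding 1(2) 2(2) char[OF 1(1)] char[OF 2(1)] by (simp add: mult_ac)
  qed
  then show thesis using that 1 2 by blast
qed

section \<open>Ingredients of the individual cases\<close>

lemma F_times_G_borel: "F_times_G a b \<in> sets borel"
proof -
  define c where "c = (\<lambda>x :: X. cis (b * fst x / (a - 1)))"
  have mem: "x \<in> subgroup_F a b \<longleftrightarrow> complex_of_circle (snd x) = c x" for x
    by (cases x) (auto simp: subgroup_F_def tau_def c_def image_iff complex_of_circle_inject[symmetric])
  have G: "x \<in> subgroup_G \<longleftrightarrow> fst x = 0 \<and> (complex_of_circle (snd x) = 1 \<or> complex_of_circle (snd x) = - 1)" for x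
    by (cases x) (auto simp: subgroup_G_def complex_of_circle_inject[symmetric])
  have "F_times_G a b = {x. complex_of_circle (snd x) = c x} \<union> {x. complex_of_circle (snd x) = - c x}"
  proof (intro equalityI subsetI)
    fix x assume "x \<in> F_times_G a b"
    then obtain f g where "x = f + g" "f \<in> subgroup_F a b" "g \<in> subgroup_G"
      by (auto simp: F_times_G_def)
    then show "x \<in> {x. complex_of_circle (snd x) = c x} \<union> {x. complex_of_circle (snd x) = - c x}"
      by (auto simp: mem G c_def plus_circle.rep_eq)
  next
    fix x assume x: "x \<in> {x. complex_of_circle (snd x) = c x} \<union> {x. complex_of_circle (snd x) = - c x}"
    define f :: X where "f = (fst x, circle_of_complex (c x))"
    have "f \<in> subgroup_F a b" by (simp add: mem f_def c_def)
    moreover have "x - f \<in> subgroup_G"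
      using x by (auto simp: G f_def minus_circle.rep_eq c_def)
    moreover have "x = f + (x - f)" by simp
    ultimately show "x \<in> F_times_G a b"
      unfolding F_times_G_def by blast
  qed
  moreover have "continuous_on UNIV c"
    unfolding c_def cis_conv_exp by (cases "a = 1") (auto intro!: continuous_intros)
  then have "closed ({x. complex_of_circle (snd x) = c x} \<union> {x. complex_of_circle (snd x) = - c x})"
    by (intro closed_Un closed_Collect_eq continuous_intros continuous_on_complex_of_circle)
  ultimately show ?thesis by simp
qed

lemma distr_tau_prob_on:
  assumes N: "N \<in> prob_R_Z2"
  shows "distr N borel (tau a b) \<in> prob_on (F_times_G a b)"
proof -
  interpret prob_space N using N by (rule prob_space_prob_R_Z2)
  note [measurable_cong] = sets_prob_R_Z2[OF N]
  have "tau a b p \<in> F_times_G a b" for p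
  proof -
    have "tau a b p = tau a b (fst p, 0) + (0, circle_of_complex (minus_one_power (snd p)))"
      by (cases "snd p") (auto simp: tau_def case_prod_unfold plus_circle.rep_eq complex_of_circle_inject[symmetric])
    moreover have "tau a b (fst p, 0) \<in> subgroup_F a b" by (simp add: subgroup_F_def)
    moreover have "(0, circle_of_complex (minus_one_power (snd p))) \<in> subgroup_G"
      by (cases "snd p") (auto simp: subgroup_G_def)
    ultimately show ?thesis unfolding F_times_G_def by blast
  qed
  then have "tau a b -` F_times_G a b = UNIV" by auto
  then show ?thesis
    using F_times_G_borel by (auto simp: prob_on_def measure_distr prob_space intro!: prob_space_distr)
qed

text \<open>When the odd component vanishes, N cannot be told apart from its projection M to the
  line with bit 0 followed by a uniform random bit, and \<open>m_G\<close> is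
  \<open>two_point_G 0\<close>.\<close>

lemma gaussian_F_convol_m_G:
  assumes N: "N \<in> prob_R_Z2" and gauss: "distr N borel fst \<in> gaussian"
    and zero: "\<And>s. char_R_Z2 N (s, 1) = 0"
  shows "\<exists>\<gamma>\<in>gaussian_F a b. distr N borel (tau a b) = \<gamma> \<^bold>* m_G"
proof -
  interpret prob_space N using N by (rule prob_space_prob_R_Z2)
  note [measurable_cong] = sets_prob_R_Z2[OF N]
  define M :: "(real \<times> bit) measure" where "M = distr N (borel \<Otimes>\<^sub>M count_space UNIV) (\<lambda>p. (fst p, 0))"
  have M: "M \<in> prob_R_Z2"
    by (auto simp: prob_R_Z2_def borel_R_Z2_def M_def intro!: prob_space_distr)
  have "char_R_Z2 N (s, 0) = char_R_Z2 M (s, 0)" for s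
    by (simp add: M_def char_R_Z2_psi integral_distr) (simp add: psi_def)
  then have "distr N borel (tau a b) = distr M borel (tau a b) \<^bold>* m_G"
    unfolding m_G_eq using zero by (intro tau_convol_two_point_G[OF M N]) auto
  moreover have "distr M borel (tau a b) = distr (distr N borel fst) borel (\<lambda>t. tau a b (t, 0))"
  proof -
    have [measurable]: "(\<lambda>t. tau a b (t, 0)) \<in> borel_measurable borel" by measurable
    show ?thesis unfolding M_def by (simp add: distr_distr comp_def)
  qed
  ultimately show ?thesis using gauss unfolding gaussian_F_def by blast
qed

text \<open>The ratio of the two functions is constant, and Hermitian symmetry makes it real. Either
  it or its inverse has absolute value at most 1, which is the source of the two directions in the
  case a = -1; if one function vanishes identically, c = 0 serves.\<close>

lemma proportional_hermitian:
  fixes f g :: "real \<Rightarrow> complex"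
  assumes eq: "\<And>p q. f p * g q = f q * g p"
    and herm: "\<And>x. f (- x) = cnj (f x)" "\<And>x. g (- x) = cnj (g x)"
  shows "\<exists>c :: real. \<bar>c\<bar> \<le> 1 \<and> ((\<forall>x. g x = of_real c * f x) \<or> (\<forall>x. f x = of_real c * g x))"
proof (cases "(\<exists>p. f p \<noteq> 0) \<and> (\<exists>p. g p \<noteq> 0)")
  case False
  then show ?thesis by (intro exI[of _ 0]) auto
next
  case True
  then obtain p where p: "f p \<noteq> 0" by blast
  define d where "d = g p / f p"
  have gd: "g x = d * f x" for x
    using eq[of p x] p by (simp add: d_def field_simps)
  have "cnj d * cnj (f p) = cnj (g p)" by (simp add: gd)
  also have "\<dots> = g (- p)" by (simp add: herm)
  also have "\<dots> = d * f (- p)" by (rule gd)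
  also have "\<dots> = d * cnj (f p)" by (simp add: herm)
  finally have "cnj d = d" using p by simp
  then obtain c where c: "d = of_real c" by (metis Reals_cases Reals_cnj_iff)
  have "c \<noteq> 0" using True gd c by auto
  show ?thesis
  proof (cases "\<bar>c\<bar> \<le> 1")
    case True
    then show ?thesis using gd c by blast
  next
    case False
    then have "\<bar>1 / c\<bar> \<le> 1" by simp
    moreover have "f x = of_real (1 / c) * g x" for x
      using gd[of x] c \<open>c \<noteq> 0\<close> by simp
    ultimately show ?thesis by blast
  qed
qed

section \<open>Assembly of the cases\<close>

theorem theorem3p1:
  fixes P :: "'p measure" and \<xi>1 \<xi>2 :: "'p \<Rightarrow> real \<times> circle"
    and \<mu>1 \<mu>2 :: "(real \<times> circle) measure" and a b :: real
  assumes "prob_space P"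
    and "a \<noteq> 0"
    and "prob_space.indep_var P borel \<xi>1 borel \<xi>2"
    and "\<mu>1 = distr P borel \<xi>1" and "\<mu>2 = distr P borel \<xi>2"
    and "cond_symmetric P (\<lambda>\<omega>. \<xi>1 \<omega> + alpha a b (\<xi>2 \<omega>)) (\<lambda>\<omega>. \<xi>1 \<omega> + \<xi>2 \<omega>)"
  shows
    "(a < 0 \<and> a \<noteq> -1 \<longrightarrow>
       (\<exists>x1 x2. \<exists>N1\<in>Lambda_class. \<exists>N2\<in>Lambda_class.
          \<mu>1 = distr N1 borel (tau a b) \<^bold>* degenerate x1 \<and>
          \<mu>2 = distr N2 borel (tau a b) \<^bold>* degenerate x2 \<and>
          ((\<exists>\<gamma>1\<in>gaussian_F a b. \<mu>1 = \<gamma>1 \<^bold>* m_G \<^bold>* degenerate x1) \<or>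
           (\<exists>\<gamma>2\<in>gaussian_F a b. \<mu>2 = \<gamma>2 \<^bold>* m_G \<^bold>* degenerate x2)))
       \<or>
       ((\<exists>x1 x2. \<exists>N1\<in>Theta_class. \<exists>N2\<in>Theta_class.
          \<mu>1 = distr N1 borel (tau a b) \<^bold>* degenerate x1 \<and>
          \<mu>2 = distr N2 borel (tau a b) \<^bold>* degenerate x2) \<and>
        (\<forall>y. char_X \<mu>1 y \<noteq> 0) \<and> (\<forall>y. char_X \<mu>2 y \<noteq> 0)))
     \<and>
     (a = -1 \<longrightarrow>
       (\<exists>x1 x2. \<exists>\<nu>1\<in>prob_on (F_times_G a b). \<exists>\<nu>2\<in>prob_on (F_times_G a b).
          \<mu>1 = \<nu>1 \<^bold>* degenerate x1 \<and> \<mu>2 = \<nu>2 \<^bold>* degenerate x2 \<and>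
          ((\<exists>\<omega>1\<in>prob_on subgroup_G. \<nu>2 = \<nu>1 \<^bold>* \<omega>1) \<or> (\<exists>\<omega>2\<in>prob_on subgroup_G. \<nu>1 = \<nu>2 \<^bold>* \<omega>2))))
     \<and>
     (a > 0 \<longrightarrow>
       (\<exists>x1. \<mu>1 \<^bold>* degenerate x1 \<in> prob_on subgroup_G) \<and> (\<exists>x2. \<mu>2 \<^bold>* degenerate x2 \<in> prob_on subgroup_G))"
proof -
  interpret P: prob_space P by fact
  have "\<xi>1 \<in> borel_measurable P" "\<xi>2 \<in> borel_measurable P"
    using P.indep_var_rv1[OF assms(3)] P.indep_var_rv2[OF assms(3)] by auto
  then have \<mu>1: "prob_space \<mu>1" "sets \<mu>1 = sets borel" and \<mu>2: "prob_space \<mu>2" "sets \<mu>2 = sets borel"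
    by (auto simp: assms(4,5) intro: P.prob_space_distr)
  have eq: "char_X \<mu>1 (s1 + s2, n1 + n2) * char_X \<mu>2 (s1 + (a * s2 + b * of_int n2), n1 + n2) =
      char_X \<mu>1 (s1 - s2, n1 - n2) * char_X \<mu>2 (s1 - (a * s2 + b * of_int n2), n1 - n2)" for s1 s2 n1 n2
    unfolding assms(4,5) by (rule heyde_equation[OF assms(1,3,6)])
  note reduction = heyde_reduction[OF \<mu>1 \<mu>2 _ eq]
  have nz0: "char_R_Z2 N (0, 0) \<noteq> 0" if "N \<in> prob_R_Z2" for N
    using char_R_Z2_zero[OF that] by simp
  have form0: "\<exists>\<sigma>1 \<sigma>2 \<beta>1 \<beta>2. \<sigma>1 \<ge> 0 \<and> \<sigma>2 \<ge> 0 \<and> \<sigma>1 + a * \<sigma>2 = 0 \<and>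
      (\<forall>s. char_R_Z2 N1 (s, 0) = exp (of_real (- \<sigma>1 * s\<^sup>2) + \<i> * of_real (\<beta>1 * s))) \<and>
      (\<forall>s. char_R_Z2 N2 (s, 0) = exp (of_real (- \<sigma>2 * s\<^sup>2) + \<i> * of_real (\<beta>2 * s)))"
    if N: "N1 \<in> prob_R_Z2" "N2 \<in> prob_R_Z2" and a: "a \<noteq> 1" "a \<noteq> -1"
      and eqN: "\<And>s1 s2 l. char_R_Z2 N1 (s1 + s2, l) * char_R_Z2 N2 (s1 + a * s2, l) =
        char_R_Z2 N1 (s1 - s2, l) * char_R_Z2 N2 (s1 - a * s2, l)" for N1 N2
  proof -
    from heyde_R_Z2_form[OF N assms(2) a eqN nz0[OF N(1)] nz0[OF N(2)]]
    obtain \<kappa>1 \<sigma>1 \<beta>1 \<kappa>2 \<sigma>2 \<beta>2 where *: "\<sigma>1 \<ge> 0" "\<sigma>2 \<ge> 0" "\<sigma>1 + a * \<sigma>2 = 0"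
      "char_R_Z2 N1 (0, 0) = of_real \<kappa>1" "char_R_Z2 N2 (0, 0) = of_real \<kappa>2"
      "\<And>s. char_R_Z2 N1 (s, 0) = of_real \<kappa>1 * exp (of_real (- \<sigma>1 * s\<^sup>2) + \<i> * of_real (\<beta>1 * s))"
      "\<And>s. char_R_Z2 N2 (s, 0) = of_real \<kappa>2 * exp (of_real (- \<sigma>2 * s\<^sup>2) + \<i> * of_real (\<beta>2 * s))"
      by metis
    \<comment> \<open>The constants are the values at the trivial character.\<close>
    have "\<kappa>1 = 1" "\<kappa>2 = 1"
      using *(4,5) char_R_Z2_zero[OF N(1)] char_R_Z2_zero[OF N(2)] by simp_all
    then show ?thesis using * by (metis mult_1 of_real_1)
  qed
  have part1: "(\<exists>x1 x2. \<exists>N1\<in>Lambda_class. \<exists>N2\<in>Lambda_class.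
          \<mu>1 = distr N1 borel (tau a b) \<^bold>* degenerate x1 \<and>
          \<mu>2 = distr N2 borel (tau a b) \<^bold>* degenerate x2 \<and>
          ((\<exists>\<gamma>1\<in>gaussian_F a b. \<mu>1 = \<gamma>1 \<^bold>* m_G \<^bold>* degenerate x1) \<or>
           (\<exists>\<gamma>2\<in>gaussian_F a b. \<mu>2 = \<gamma>2 \<^bold>* m_G \<^bold>* degenerate x2)))
       \<or>
       ((\<exists>x1 x2. \<exists>N1\<in>Theta_class. \<exists>N2\<in>Theta_class.
          \<mu>1 = distr N1 borel (tau a b) \<^bold>* degenerate x1 \<and>
          \<mu>2 = distr N2 borel (tau a b) \<^bold>* degenerate x2) \<and>
        (\<forall>y. char_X \<mu>1 y \<noteq> 0) \<and> (\<forall>y. char_X \<mu>2 y \<noteq> 0))"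
    (is "?A \<or> ?B") if "a < 0" "a \<noteq> -1"
  proof -
    have a: "a \<noteq> 0" "a \<noteq> 1" "a \<noteq> -1" using that by auto
    obtain e1 e2 N1 N2 where N: "N1 \<in> prob_R_Z2" "N2 \<in> prob_R_Z2"
      and rep: "\<mu>1 = distr N1 borel (tau a b) \<^bold>* degenerate (0, e1)"
        "\<mu>2 = distr N2 borel (tau a b) \<^bold>* degenerate (0, e2)"
      and eqN: "\<And>s1 s2 l. char_R_Z2 N1 (s1 + s2, l) * char_R_Z2 N2 (s1 + a * s2, l) =
        char_R_Z2 N1 (s1 - s2, l) * char_R_Z2 N2 (s1 - a * s2, l)"
      by (rule reduction[OF a(2)]) blast
    obtain \<sigma>1 \<sigma>2 \<beta>1 \<beta>2 where \<sigma>: "\<sigma>1 \<ge> 0" "\<sigma>2 \<ge> 0"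
      and form: "\<And>s. char_R_Z2 N1 (s, 0) = exp (of_real (- \<sigma>1 * s\<^sup>2) + \<i> * of_real (\<beta>1 * s))"
        "\<And>s. char_R_Z2 N2 (s, 0) = exp (of_real (- \<sigma>2 * s\<^sup>2) + \<i> * of_real (\<beta>2 * s))"
      using form0[OF N a(2,3) eqN] by blast
    have gauss: "distr N1 borel fst \<in> gaussian" "distr N2 borel fst \<in> gaussian"
      by (rule gaussian_if_char_R_Z2[OF N(1) \<sigma>(1) form(1)], rule gaussian_if_char_R_Z2[OF N(2) \<sigma>(2) form(2)])
    \<comment> \<open>The odd components decide the alternative: a zero one produces
      \<open>m_G\<close>, two nonzero ones are Gaussian up to constants and have no zeros at
      all.\<close>
    show ?thesis
    proof (cases "(\<forall>s. char_R_Z2 N1 (s, 1) = 0) \<or> (\<forall>s. char_R_Z2 N2 (s, 1) = 0)")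
      case True
      have "N1 \<in> Lambda_class" "N2 \<in> Lambda_class"
        using N gauss by (auto simp: Lambda_class_def)
      moreover have "(\<exists>\<gamma>1\<in>gaussian_F a b. \<mu>1 = \<gamma>1 \<^bold>* m_G \<^bold>* degenerate (0, e1)) \<or>
          (\<exists>\<gamma>2\<in>gaussian_F a b. \<mu>2 = \<gamma>2 \<^bold>* m_G \<^bold>* degenerate (0, e2))"
        using True gaussian_F_convol_m_G[OF N(1) gauss(1)] gaussian_F_convol_m_G[OF N(2) gauss(2)] rep
        by metis
      ultimately have ?A using rep by blast
      then show ?thesis ..
    next
      case False
      then obtain x y where xy: "char_R_Z2 N1 (x, 1) \<noteq> 0" "char_R_Z2 N2 (y, 1) \<noteq> 0" by blast
      from heyde_R_Z2_form[OF N a eqN xy]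
      obtain \<kappa>1 \<sigma>1' \<beta>1' \<kappa>2 \<sigma>2' \<beta>2' where *: "\<sigma>1' \<ge> 0" "\<sigma>2' \<ge> 0" "\<kappa>1 \<noteq> 0" "\<kappa>2 \<noteq> 0"
        "\<And>s. char_R_Z2 N1 (s, 1) = of_real \<kappa>1 * exp (of_real (- \<sigma>1' * s\<^sup>2) + \<i> * of_real (\<beta>1' * s))"
        "\<And>s. char_R_Z2 N2 (s, 1) = of_real \<kappa>2 * exp (of_real (- \<sigma>2' * s\<^sup>2) + \<i> * of_real (\<beta>2' * s))"
        by metis
      have "N1 \<in> Theta_class" "N2 \<in> Theta_class"
        by (rule Theta_classI[OF N(1) \<sigma>(1) *(1,3) form(1) *(5)],
            rule Theta_classI[OF N(2) \<sigma>(2) *(2,4) form(2) *(6)])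
      moreover have "char_X \<mu>1 y \<noteq> 0" "char_X \<mu>2 y \<noteq> 0" for y
        unfolding rep using *(3,4)
        by (cases y; simp add: char_X_tau N form *(5,6))+
      ultimately have ?B using rep by blast
      then show ?thesis ..
    qed
  qed
  have part2: "\<exists>x1 x2. \<exists>\<nu>1\<in>prob_on (F_times_G a b). \<exists>\<nu>2\<in>prob_on (F_times_G a b).
          \<mu>1 = \<nu>1 \<^bold>* degenerate x1 \<and> \<mu>2 = \<nu>2 \<^bold>* degenerate x2 \<and>
          ((\<exists>\<omega>1\<in>prob_on subgroup_G. \<nu>2 = \<nu>1 \<^bold>* \<omega>1) \<or> (\<exists>\<omega>2\<in>prob_on subgroup_G. \<nu>1 = \<nu>2 \<^bold>* \<omega>2))"
    if a: "a = -1"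
  proof -
    have "a \<noteq> 1" using a by simp
    obtain e1 e2 N1 N2 where N: "N1 \<in> prob_R_Z2" "N2 \<in> prob_R_Z2"
      and rep: "\<mu>1 = distr N1 borel (tau a b) \<^bold>* degenerate (0, e1)"
        "\<mu>2 = distr N2 borel (tau a b) \<^bold>* degenerate (0, e2)"
      and eqN: "\<And>s1 s2 l. char_R_Z2 N1 (s1 + s2, l) * char_R_Z2 N2 (s1 + a * s2, l) =
        char_R_Z2 N1 (s1 - s2, l) * char_R_Z2 N2 (s1 - a * s2, l)"
      by (rule reduction[OF \<open>a \<noteq> 1\<close>]) blast
    \<comment> \<open>For a = -1 the map s1 + a * s2 is s1 - s2, so p and q are the sum and the
      difference of s1 and s2.\<close>
    have cross: "char_R_Z2 N1 (p, l) * char_R_Z2 N2 (q, l) = char_R_Z2 N1 (q, l) * char_R_Z2 N2 (p, l)" for p q l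
    proof -
      have "(p + q) / 2 + (p - q) / 2 = p" "(p + q) / 2 - (p - q) / 2 = q"
        "(p + q) / 2 + a * ((p - q) / 2) = q" "(p + q) / 2 - a * ((p - q) / 2) = p"
        using a by (simp_all add: field_simps)
      then show ?thesis using eqN[of "(p + q) / 2" "(p - q) / 2" l] by (simp only:)
    qed
    have eq0: "char_R_Z2 N1 (s, 0) = char_R_Z2 N2 (s, 0)" for s
      using cross[of s 0 0] char_R_Z2_zero[OF N(1)] char_R_Z2_zero[OF N(2)] by simp
    obtain c :: real where c: "\<bar>c\<bar> \<le> 1"
      "(\<forall>s. char_R_Z2 N2 (s, 1) = of_real c * char_R_Z2 N1 (s, 1)) \<or>
       (\<forall>s. char_R_Z2 N1 (s, 1) = of_real c * char_R_Z2 N2 (s, 1))"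
      using proportional_hermitian[of "\<lambda>s. char_R_Z2 N1 (s, 1)" "\<lambda>s. char_R_Z2 N2 (s, 1)",
          OF cross char_R_Z2_uminus char_R_Z2_uminus] by blast
    have "distr N2 borel (tau a b) = distr N1 borel (tau a b) \<^bold>* two_point_G c \<or>
        distr N1 borel (tau a b) = distr N2 borel (tau a b) \<^bold>* two_point_G c"
      using c(2) tau_convol_two_point_G[OF N c(1) eq0[symmetric]]
        tau_convol_two_point_G[OF N(2,1) c(1) eq0] by blast
    then show ?thesis
      using rep distr_tau_prob_on[OF N(1)] distr_tau_prob_on[OF N(2)] two_point_G_prob_on by blast
  qed
  have part3: "(\<exists>x1. \<mu>1 \<^bold>* degenerate x1 \<in> prob_on subgroup_G) \<and> (\<exists>x2. \<mu>2 \<^bold>* degenerate x2 \<in> prob_on subgroup_G)"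
    if "a > 0"
  proof (cases "a = 1")
    case True
    \<comment> \<open>For a = 1 the adjoint fixes every \<open>(s, 0)\<close>, and u = v makes the
      right-hand side trivial.\<close>
    have "norm (char_X \<mu>1 (s, 0) * char_X \<mu>2 (s, 0)) = 1" for s
      using eq[of "s / 2" "s / 2" 0 0] True char_X_zero[OF \<mu>1(1)] char_X_zero[OF \<mu>2(1)] by simp
    note 1 = norms_eq_1_if_mult_eq_1[OF this norm_char_X_le[OF \<mu>1(1)] norm_char_X_le[OF \<mu>2(1)]]
    \<comment> \<open>At u = v = (0, 1) the right-hand side is the value of the second
      characteristic function at \<open>(- b, 0)\<close>, which has modulus 1 by the preceding
      fact.\<close>
    have "norm (char_X \<mu>1 (0, 2) * char_X \<mu>2 (b, 2)) = 1"
      using eq[of 0 0 1 1] 1(2)[of "- b"] char_X_zero[OF \<mu>1(1)] by simp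
    note 2 = norms_eq_1_if_mult_eq_1[OF this norm_char_X_le[OF \<mu>1(1)] norm_char_X_le[OF \<mu>2(1)]]
    show ?thesis
      using prob_on_subgroup_G_if_norm_char_1[OF \<mu>1 1(1) 2(1)]
        prob_on_subgroup_G_if_norm_char_1[OF \<mu>2 1(2) 2(2)] by blast
  next
    case False
    have a: "a \<noteq> 1" "a \<noteq> -1" using False that by auto
    obtain e1 e2 N1 N2 where N: "N1 \<in> prob_R_Z2" "N2 \<in> prob_R_Z2"
      and rep: "\<mu>1 = distr N1 borel (tau a b) \<^bold>* degenerate (0, e1)"
        "\<mu>2 = distr N2 borel (tau a b) \<^bold>* degenerate (0, e2)"
      and eqN: "\<And>s1 s2 l. char_R_Z2 N1 (s1 + s2, l) * char_R_Z2 N2 (s1 + a * s2, l) =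
        char_R_Z2 N1 (s1 - s2, l) * char_R_Z2 N2 (s1 - a * s2, l)"
      by (rule reduction[OF False]) blast
    obtain \<sigma>1 \<sigma>2 \<beta>1 \<beta>2 where \<sigma>: "\<sigma>1 \<ge> 0" "\<sigma>2 \<ge> 0" "\<sigma>1 + a * \<sigma>2 = 0"
      and form: "\<And>s. char_R_Z2 N1 (s, 0) = exp (of_real (- \<sigma>1 * s\<^sup>2) + \<i> * of_real (\<beta>1 * s))"
        "\<And>s. char_R_Z2 N2 (s, 0) = exp (of_real (- \<sigma>2 * s\<^sup>2) + \<i> * of_real (\<beta>2 * s))"
      using form0[OF N a eqN] by blast
    have "a * \<sigma>2 \<ge> 0" using \<sigma>(2) that by simp
    with \<sigma> have "\<sigma>1 = 0" "a * \<sigma>2 = 0" by linarith+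
    then have \<sigma>0: "\<sigma>1 = 0" "\<sigma>2 = 0" using that by auto
    have "norm (char_R_Z2 N1 (s, 0)) = 1" "norm (char_R_Z2 N2 (s, 0)) = 1" for s
      unfolding form \<sigma>0 by simp_all
    \<comment> \<open>The character (0, 2) is even, so it too is evaluated through the degenerate
      component with l = 0, at a shifted frequency.\<close>
    then have "norm (char_X \<mu>1 (s, 0)) = 1" "norm (char_X \<mu>2 (s, 0)) = 1"
      "norm (char_X \<mu>1 (0, 2)) = 1" "norm (char_X \<mu>2 (0, 2)) = 1" for s
      unfolding rep char_X_tau[OF N(1)] char_X_tau[OF N(2)] by (simp_all add: norm_mult)
    then show ?thesis
      using prob_on_subgroup_G_if_norm_char_1[OF \<mu>1] prob_on_subgroup_G_if_norm_char_1[OF \<mu>2] by blast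
  qed
  show ?thesis using part1 part2 part3 by blast
qed

end
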